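(* The topological groups $\mathrm{Aut}(\mathbf{S}(3))$ and $\mathrm{Aut}(\mathbf{T})$ are not amenable.
   Context: For a countable structure $\mathbf{K}$, $\mathrm{Aut}(\mathbf{K})$ is a topological group with the pointwise convergence topology: a neighborhood basis at the identity is given by the subgroups $\{g : g(a_i)=a_i \text{ for each } a_i\in\bar a\}$ for finite $\bar a\subset \mathbf{K}$. A Hausdorff topological group $G$ is amenable if every jointly continuous action of $G$ on a (nonempty) compact Hausdorff space $X$ admits a $G$-invariant Borel probability measure on $X$. The directed graph $\mathbf{S}(3)$ has vertex set $\{e^{iq}: q\in\mathbb{Q}\}$; for vertices $a=e^{iq_1}$, $b=e^{iq_2}$ there is a directed edge $a\to b$ exactly when there is $m\in\mathbb{Z}$ with $q_2-q_1\in(2\pi m, 2\pi m+2\pi/3)$. A boron tree is a graph-theoretic unrooted tree in which each vertex has degree $1$ or $3$. For a boron tree $T$, let $(T)=\langle L_T,R\rangle$ be the structure with universe $L_T$ the set of leaves (degree $1$ vertices) of $T$, and $R$ the $4$-ary relation such that $R(a,b,c,d)$ holds iff $a,b,c,d$ are distinct and the path from $a$ to $b$ and the path from $c$ to $d$ do not intersect. Let $\mathcal{B}$ be the class of all structures isomorphic to $(T)$ for some finite boron tree $T$ (together with the one-element structure with $R$ empty, so that the class is closed under substructures). $\mathcal{B}$ is a Fraïssé class, and $\mathbf{T}$ denotes its Fraïssé limit: the (unique up to isomorphism) countably infinite ultrahomogeneous structure whose finite substructures are, up to isomorphism, exactly the members of $\mathcal{B}$. (Ultrahomogeneous: every isomorphism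 between finite substructures extends to an automorphism.) *)

theory Defs
  imports "HOL-Probability.Probability_Measure" "HOL-Algebra.Group_Action"
begin

section \<open>Amenability\<close>

definition topological_group :: "('g, 'm) monoid_scheme \<Rightarrow> 'g topology \<Rightarrow> bool" where
  "topological_group G \<tau> \<longleftrightarrow>
     group G \<and> topspace \<tau> = carrier G \<and>
     continuous_map (prod_topology \<tau> \<tau>) \<tau> (\<lambda>(g, h). g \<otimes>\<^bsub>G\<^esub> h) \<and>
     continuous_map \<tau> \<tau> (\<lambda>g. inv\<^bsub>G\<^esub> g)"

definition continuous_action ::
  "('g, 'm) monoid_scheme \<Rightarrow> 'g topology \<Rightarrow> 'x topology \<Rightarrow> ('g \<Rightarrow> 'x \<Rightarrow> 'x) \<Rightarrow> bool" where
  "continuous_action G \<tau> X \<phi> \<longleftrightarrow>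
     group_action G (topspace X) \<phi> \<and>
     continuous_map (prod_topology \<tau> X) X (\<lambda>(g, x). \<phi> g x)"

definition borel_probability_measure :: "'x topology \<Rightarrow> 'x measure \<Rightarrow> bool" where
  "borel_probability_measure X M \<longleftrightarrow>
     prob_space M \<and> space M = topspace X \<and>
     sets M = sigma_sets (topspace X) {U. openin X U}"

definition invariant_measure ::
  "('g, 'm) monoid_scheme \<Rightarrow> ('g \<Rightarrow> 'x \<Rightarrow> 'x) \<Rightarrow> 'x measure \<Rightarrow> bool" where
  "invariant_measure G \<phi> M \<longleftrightarrow> (\<forall>g\<in>carrier G. distr M M (\<phi> g) = M)"

text \<open>
  Meant for Hausdorff topological groups, to which the automorphism groups below belong
  (\<open>topological_group_Aut\<close>, \<open>Hausdorff_space_Aut\<close>).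
  A definition cannot quantify over all types, so the compact spaces range over topologies on
  \<open>'g set set\<close>. Up to homeomorphism this covers every closure of an orbit of the group, hence it
  loses no generality: lemma \<open>amenable_any_type\<close> below gives the property for
  compact Hausdorff spaces on an arbitrary type.
\<close>

definition amenable :: "('g, 'm) monoid_scheme \<Rightarrow> 'g topology \<Rightarrow> bool" where
  "amenable G \<tau> \<longleftrightarrow>
     (\<forall>(X :: 'g set set topology) \<phi>.
        compact_space X \<and> Hausdorff_space X \<and> topspace X \<noteq> {} \<and> continuous_action G \<tau> X \<phi> \<longrightarrow>
        (\<exists>M. borel_probability_measure X M \<and> invariant_measure G \<phi> M))"

lemma continuous_map_borel_measurable:
  assumes "continuous_map X Y f"
    and M: "space M = topspace X" "sets M = sigma_sets (topspace X) {U. openin X U}"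
    and N: "space N = topspace Y" "sets N = sigma_sets (topspace Y) {U. openin Y U}"
  shows "f \<in> measurable M N"
proof (rule measurable_sigma_sets)
  show "sets N = sigma_sets (topspace Y) {U. openin Y U}" by (fact N)
  show "{U. openin Y U} \<subseteq> Pow (topspace Y)" using openin_subset by blast
  show "f \<in> space M \<rightarrow> topspace Y"
    using assms(1) M by (auto simp: continuous_map_def)
  fix U assume "U \<in> {U. openin Y U}"
  then have "openin X {x \<in> topspace X. f x \<in> U}"
    using assms(1) by (simp add: continuous_map_def)
  moreover have "f -` U \<inter> space M = {x \<in> topspace X. f x \<in> U}" using M by auto
  ultimately show "f -` U \<inter> space M \<in> sets M" using M by auto
qed

lemma amenable_any_type:
  fixes G :: "('g, 'm) monoid_scheme" and X :: "'x topology"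
  assumes top: "topspace \<tau> = carrier G" and "amenable G \<tau>"
    and X: "compact_space X" "Hausdorff_space X" "topspace X \<noteq> {}"
    and act: "continuous_action G \<tau> X \<phi>"
  shows "\<exists>M. borel_probability_measure X M \<and> invariant_measure G \<phi> M"
proof -
  interpret group_action G "topspace X" \<phi>
    using act by (simp add: continuous_action_def)
  interpret grp: group G using group_hom by (simp add: group_hom_def)
  have joint: "continuous_map (prod_topology \<tau> X) X (\<lambda>(g, x). \<phi> g x)"
    using act by (simp add: continuous_action_def)
  have cont: "continuous_map X X (\<phi> g)" if "g \<in> carrier G" for g
  proof -
    have "continuous_map X (prod_topology \<tau> X) (\<lambda>x. (g, x))"
      using that top by (simp add: continuous_map_pairedI)
    from continuous_map_compose[OF this joint] show ?thesis by (simp add: o_def)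
  qed
  have mult: "\<phi> (g \<otimes>\<^bsub>G\<^esub> h) x = \<phi> g (\<phi> h x)"
    if "g \<in> carrier G" "h \<in> carrier G" "x \<in> topspace X" for g h x
    using composition_rule[OF that(3) that(1) that(2)] by simp
  obtain x where x: "x \<in> topspace X" using X(3) by blast
  define C where "C = X closure_of ((\<lambda>g. \<phi> g x) ` carrier G)"
  have CX: "C \<subseteq> topspace X" by (simp add: C_def closure_of_subset_topspace)
  have orb: "(\<lambda>g. \<phi> g x) ` carrier G \<subseteq> topspace X" using element_image x by blast
  have Cne: "C \<noteq> {}"
    using closure_of_subset[OF orb] grp.one_closed unfolding C_def by blast
  have inv: "\<phi> g c \<in> C" if g: "g \<in> carrier G" and c: "c \<in> C" for g c
  proof -
    have "\<phi> g ` C \<subseteq> X closure_of (\<phi> g ` (\<lambda>g. \<phi> g x) ` carrier G)"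
      unfolding C_def by (rule continuous_map_image_closure_subset[OF cont[OF g]])
    also have "\<dots> \<subseteq> C" unfolding C_def
    proof (rule closure_of_mono)
      have "\<phi> g (\<phi> h x) \<in> (\<lambda>g. \<phi> g x) ` carrier G" if "h \<in> carrier G" for h
        using mult[OF g that x] grp.m_closed[OF g that] by (metis imageI)
      then show "\<phi> g ` (\<lambda>g. \<phi> g x) ` carrier G \<subseteq> (\<lambda>g. \<phi> g x) ` carrier G" by blast
    qed
    finally show ?thesis using c by blast
  qed
  \<comment> \<open>A point of the orbit closure is determined by the sets of group elements whose
    part of the orbit accumulates at it.\<close>
  define j where "j c = {S. S \<subseteq> carrier G \<and> c \<in> X closure_of ((\<lambda>g. \<phi> g x) ` S)}" for c
  have inj: "inj_on j C"
  proof (rule inj_onI, rule ccontr)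
    fix c d assume c: "c \<in> C" and d: "d \<in> C" and eq: "j c = j d" and "c \<noteq> d"
    then obtain U V where UV: "openin X U" "openin X V" "c \<in> U" "d \<in> V" "disjnt U V"
      using X(2) CX unfolding Hausdorff_space_def by (meson subsetD)
    define S where "S = {g \<in> carrier G. \<phi> g x \<in> U}"
    have "c \<in> X closure_of ((\<lambda>g. \<phi> g x) ` S)"
      unfolding in_closure_of
    proof (intro conjI allI impI)
      show "c \<in> topspace X" using c CX by blast
      fix W assume "c \<in> W \<and> openin X W"
      then have "c \<in> W \<inter> U" "openin X (W \<inter> U)" using UV by auto
      then obtain y where "y \<in> (\<lambda>g. \<phi> g x) ` carrier G" "y \<in> W \<inter> U"
        using c unfolding C_def in_closure_of by blast
      then show "\<exists>y. y \<in> (\<lambda>g. \<phi> g x) ` S \<and> y \<in> W" unfolding S_def by blast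
    qed
    then have "S \<in> j c" by (auto simp: j_def S_def)
    then have "S \<in> j d" using eq by simp
    then have "d \<in> X closure_of ((\<lambda>g. \<phi> g x) ` S)" by (simp add: j_def)
    then obtain y where "y \<in> (\<lambda>g. \<phi> g x) ` S" "y \<in> V"
      using UV unfolding in_closure_of by blast
    then show False using UV unfolding S_def disjnt_def by blast
  qed
  define k where "k = inv_into C j"
  have kj: "k (j c) = c" if "c \<in> C" for c using inj that by (simp add: k_def)
  define Z where "Z = pullback_topology (j ` C) k X"
  have topZ: "topspace Z = j ` C"
    unfolding Z_def topspace_pullback_topology using kj CX by auto
  have topC: "topspace (subtopology X C) = C" using CX by auto
  have jcont: "continuous_map (subtopology X C) Z j"
    unfolding Z_def
  proof (rule continuous_map_pullback')
    show "continuous_map (subtopology X C) X (k \<circ> j)"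
      by (rule continuous_map_eq[of _ _ id]) (use kj topC in auto)
    show "topspace (subtopology X C) \<subseteq> j -` j ` C" using topC by auto
  qed
  have kcontX: "continuous_map Z X k"
    unfolding Z_def using continuous_map_pullback[of X X id "j ` C" k] by simp
  have kcont: "continuous_map Z (subtopology X C) k"
    using kcontX kj topZ by (auto simp: continuous_map_in_subtopology)
  have hom: "homeomorphic_maps (subtopology X C) Z j k"
    unfolding homeomorphic_maps_def using jcont kcont kj topC topZ by auto
  then have homeo: "subtopology X C homeomorphic_space Z"
    using homeomorphic_space_def by blast
  have "compactin X C"
    using X(1) closedin_compact_space closedin_closure_of unfolding C_def by blast
  then have "compact_space (subtopology X C)" by (rule compact_space_subtopology)
  then have Z1: "compact_space Z" using homeo homeomorphic_compact_space by blast
  have Z2: "Hausdorff_space Z"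
    using homeo homeomorphic_Hausdorff_space Hausdorff_space_subtopology[OF X(2)] by blast
  have Z3: "topspace Z \<noteq> {}" using topZ Cne by simp
  define \<psi> where "\<psi> g = (\<lambda>z\<in>j ` C. j (\<phi> g (k z)))" for g
  have psij: "\<psi> g (j c) = j (\<phi> g c)" if "c \<in> C" for g c using that kj by (simp add: \<psi>_def)
  have bij: "\<psi> g \<in> Bij (j ` C)" if g: "g \<in> carrier G" for g
  proof -
    have gi: "inv\<^bsub>G\<^esub> g \<in> carrier G" using g by simp
    have ident: "\<phi> \<one>\<^bsub>G\<^esub> c = c" if "c \<in> C" for c
      using that CX id_eq_one by (metis restrict_apply' subsetD)
    have l: "\<phi> (inv\<^bsub>G\<^esub> g) (\<phi> g c) = c" and r: "\<phi> g (\<phi> (inv\<^bsub>G\<^esub> g) c) = c" if "c \<in> C" for c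
      using that g gi CX ident mult[of g "inv\<^bsub>G\<^esub> g" c] mult[of "inv\<^bsub>G\<^esub> g" g c] by auto
    have "bij_betw (\<psi> g) (j ` C) (j ` C)"
      by (rule bij_betw_byWitness[where f' = "\<psi> (inv\<^bsub>G\<^esub> g)"])
        (use inv g gi l r psij in auto)
    then show ?thesis by (simp add: Bij_def \<psi>_def)
  qed
  have grp_act: "group_action G (topspace Z) \<psi>"
    unfolding group_action_def group_hom_def group_hom_axioms_def topZ
  proof (intro conjI group_BijGroup homI)
    show "group G" by (fact grp.group_axioms)
    fix g h assume g: "g \<in> carrier G" and h: "h \<in> carrier G"
    show "\<psi> g \<in> carrier (BijGroup (j ` C))" using bij g by (simp add: BijGroup_def)
    have "\<psi> (g \<otimes>\<^bsub>G\<^esub> h) z = compose (j ` C) (\<psi> g) (\<psi> h) z" for z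
    proof (cases "z \<in> j ` C")
      case True
      then obtain c where "c \<in> C" "z = j c" by blast
      then show ?thesis using g h CX inv mult by (auto simp: psij compose_eq)
    qed (simp add: \<psi>_def compose_def)
    then show "\<psi> (g \<otimes>\<^bsub>G\<^esub> h) = \<psi> g \<otimes>\<^bsub>BijGroup (j ` C)\<^esub> \<psi> h"
      using bij g h by (auto simp: BijGroup_def)
  qed
  have "continuous_map (prod_topology \<tau> Z) Z (\<lambda>(g, z). \<psi> g z)"
  proof -
    have "continuous_map (prod_topology \<tau> Z) (prod_topology \<tau> X) (\<lambda>p. (fst p, k (snd p)))"
      using continuous_map_compose[OF continuous_map_snd kcontX, of \<tau>]
      by (intro continuous_map_pairedI continuous_map_fst) (simp add: o_def)
    from continuous_map_compose[OF this joint]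
    have "continuous_map (prod_topology \<tau> Z) X (\<lambda>p. \<phi> (fst p) (k (snd p)))"
      by (simp add: o_def)
    then have "continuous_map (prod_topology \<tau> Z) (subtopology X C) (\<lambda>p. \<phi> (fst p) (k (snd p)))"
      using inv kj topZ top by (auto simp: continuous_map_in_subtopology)
    from continuous_map_compose[OF this jcont]
    show ?thesis
      by (rule continuous_map_eq) (use topZ in \<open>auto simp: \<psi>_def\<close>)
  qed
  with grp_act have "continuous_action G \<tau> Z \<psi>" by (simp add: continuous_action_def)
  with assms(2) Z1 Z2 Z3 obtain M
    where M: "borel_probability_measure Z M" "invariant_measure G \<psi> M"
    unfolding amenable_def by blast
  have Msp: "space M = topspace Z" "sets M = sigma_sets (topspace Z) {U. openin Z U}"
    and "prob_space M" using M(1) by (auto simp: borel_probability_measure_def)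
  interpret prob_space M by fact
  define N0 where "N0 = sigma (topspace X) {U. openin X U}"
  have pow: "{U. openin X U} \<subseteq> Pow (topspace X)" using openin_subset by blast
  have N0: "space N0 = topspace X" "sets N0 = sigma_sets (topspace X) {U. openin X U}"
    using pow by (simp_all add: N0_def)
  define N where "N = distr M N0 k"
  have N: "space N = topspace X" "sets N = sigma_sets (topspace X) {U. openin X U}"
    using N0 by (simp_all add: N_def)
  have kmeas: "k \<in> measurable M N0"
    by (rule continuous_map_borel_measurable[OF kcontX Msp N0])
  have "prob_space N" unfolding N_def by (rule prob_space_distr[OF kmeas])
  moreover have "distr N N (\<phi> g) = N" if g: "g \<in> carrier G" for g
  proof -
    have phi: "\<phi> g \<in> measurable N0 N0"
      by (rule continuous_map_borel_measurable[OF cont[OF g] N0 N0])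
    have "continuous_map Z Z (\<psi> g)"
    proof -
      have "continuous_map Z (prod_topology \<tau> Z) (\<lambda>z. (g, z))"
        using g top by (simp add: continuous_map_pairedI)
      from continuous_map_compose[OF this \<open>continuous_map (prod_topology \<tau> Z) Z (\<lambda>(g, z). \<psi> g z)\<close>]
      show ?thesis by (simp add: o_def)
    qed
    then have psi: "\<psi> g \<in> measurable M M"
      by (rule continuous_map_borel_measurable[OF _ Msp Msp])
    have "distr N N (\<phi> g) = distr N N0 (\<phi> g)"
      by (rule distr_cong) (simp_all add: N_def)
    also have "\<dots> = distr M N0 (\<phi> g \<circ> k)"
      unfolding N_def by (rule distr_distr[OF phi kmeas])
    also have "\<dots> = distr M N0 (k \<circ> \<psi> g)"
      by (rule distr_cong) (use Msp topZ inv g kj psij in auto)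
    also have "\<dots> = distr (distr M M (\<psi> g)) N0 k"
      by (rule distr_distr[OF kmeas psi, symmetric])
    also have "\<dots> = N" using M(2) g by (simp add: invariant_measure_def N_def)
    finally show ?thesis .
  qed
  ultimately show ?thesis
    using N by (auto simp: borel_probability_measure_def invariant_measure_def)
qed


section \<open>Relational structures and their automorphism groups\<close>

text \<open>
  A structure carries at most one relation symbol of each arity; \<open>rel\<close> collects the tuples of all
  of them as lists.
\<close>

record 'a rel_structure =
  universe :: "'a set"
  rel :: "'a list set"

definition well_formed :: "'a rel_structure \<Rightarrow> bool" where
  "well_formed K \<longleftrightarrow> rel K \<subseteq> lists (universe K)"

definition substructure :: "'a rel_structure \<Rightarrow> 'a set \<Rightarrow> 'a rel_structure" where
  "substructure K A = \<lparr>universe = A, rel = rel K \<inter> lists A\<rparr>"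

definition is_isomorphism ::
  "('a \<Rightarrow> 'b) \<Rightarrow> 'a rel_structure \<Rightarrow> 'b rel_structure \<Rightarrow> bool" where
  "is_isomorphism f K L \<longleftrightarrow>
     bij_betw f (universe K) (universe L) \<and>
     (\<forall>xs\<in>lists (universe K). xs \<in> rel K \<longleftrightarrow> map f xs \<in> rel L)"

definition isomorphic :: "'a rel_structure \<Rightarrow> 'b rel_structure \<Rightarrow> bool" where
  "isomorphic K L \<longleftrightarrow> (\<exists>f. is_isomorphism f K L)"

definition Aut :: "'a rel_structure \<Rightarrow> ('a \<Rightarrow> 'a) monoid" where
  "Aut K = BijGroup (universe K) \<lparr>carrier := {f \<in> Bij (universe K). is_isomorphism f K K}\<rparr>"

text \<open>The topology of pointwise convergence, for the discrete topology on the structure.\<close>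

definition Aut_topology :: "'a rel_structure \<Rightarrow> ('a \<Rightarrow> 'a) topology" where
  "Aut_topology K =
     subtopology (product_topology (\<lambda>_. discrete_topology (universe K)) (universe K)) (carrier (Aut K))"

lemma subgroup_Aut:
  "subgroup {f \<in> Bij (universe K). is_isomorphism f K K} (BijGroup (universe K))"
proof (rule group.subgroupI[OF group_BijGroup])
  show "{f \<in> Bij (universe K). is_isomorphism f K K} \<subseteq> carrier (BijGroup (universe K))"
    by (auto simp: BijGroup_def)
  have "(\<lambda>x\<in>universe K. x) \<in> {f \<in> Bij (universe K). is_isomorphism f K K}"
  proof -
    have "map (\<lambda>x\<in>universe K. x) xs = xs" if "xs \<in> lists (universe K)" for xs
      using that by (intro map_idI) auto
    then show ?thesis
      using id_Bij[of "universe K"] by (auto simp: is_isomorphism_def Bij_def)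
  qed
  then show "{f \<in> Bij (universe K). is_isomorphism f K K} \<noteq> {}" by blast
next
  fix f assume f: "f \<in> {f \<in> Bij (universe K). is_isomorphism f K K}"
  let ?h = "\<lambda>x\<in>universe K. inv_into (universe K) f x"
  have h: "?h \<in> Bij (universe K)" using f by (intro restrict_inv_into_Bij) simp
  have fb: "bij_betw f (universe K) (universe K)" using f by (simp add: is_isomorphism_def)
  have "xs \<in> rel K \<longleftrightarrow> map ?h xs \<in> rel K" if xs: "xs \<in> lists (universe K)" for xs
  proof -
    have "map ?h xs \<in> lists (universe K)"
      using xs Bij_inv_into_mem[of f "universe K"] f by (auto simp: lists_eq_set)
    moreover have "map f (map ?h xs) = xs"
      using xs fb by (auto simp: bij_betw_inv_into_right intro!: map_idI)
    ultimately show ?thesis using f by (auto simp: is_isomorphism_def)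
  qed
  then have "is_isomorphism ?h K K" using h by (simp add: is_isomorphism_def Bij_def)
  then show "inv\<^bsub>BijGroup (universe K)\<^esub> f \<in> {f \<in> Bij (universe K). is_isomorphism f K K}"
    using f h by (simp add: inv_BijGroup)
next
  fix f g
  assume f: "f \<in> {f \<in> Bij (universe K). is_isomorphism f K K}"
    and g: "g \<in> {f \<in> Bij (universe K). is_isomorphism f K K}"
  have c: "compose (universe K) f g \<in> Bij (universe K)" using f g by (simp add: compose_Bij)
  have "xs \<in> rel K \<longleftrightarrow> map (compose (universe K) f g) xs \<in> rel K" if xs: "xs \<in> lists (universe K)" for xs
  proof -
    have "map g xs \<in> lists (universe K)"
      using xs g Bij_imp_funcset[of g "universe K"] by (auto simp: lists_eq_set)
    moreover have "map (compose (universe K) f g) xs = map f (map g xs)"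
      using xs by (auto simp: compose_def)
    moreover have "xs \<in> rel K \<longleftrightarrow> map g xs \<in> rel K"
      using g xs unfolding is_isomorphism_def by blast
    moreover have "map g xs \<in> rel K \<longleftrightarrow> map f (map g xs) \<in> rel K"
      using f \<open>map g xs \<in> lists (universe K)\<close> unfolding is_isomorphism_def by blast
    ultimately show ?thesis by (simp only:)
  qed
  then have "is_isomorphism (compose (universe K) f g) K K"
    using c by (simp add: is_isomorphism_def Bij_def)
  then show "f \<otimes>\<^bsub>BijGroup (universe K)\<^esub> g \<in> {f \<in> Bij (universe K). is_isomorphism f K K}"
    using f g c by (simp add: BijGroup_def)
qed

lemma group_Aut: "group (Aut K)"
  unfolding Aut_def by (rule group.subgroup_imp_group[OF group_BijGroup subgroup_Aut])

lemma carrier_Aut: "carrier (Aut K) = {f \<in> Bij (universe K). is_isomorphism f K K}"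
  by (simp add: Aut_def)

lemma mult_Aut:
  "f \<in> carrier (Aut K) \<Longrightarrow> g \<in> carrier (Aut K) \<Longrightarrow> f \<otimes>\<^bsub>Aut K\<^esub> g = compose (universe K) f g"
  by (simp add: Aut_def BijGroup_def)

lemma inv_Aut:
  assumes "f \<in> carrier (Aut K)"
  shows "inv\<^bsub>Aut K\<^esub> f = (\<lambda>x\<in>universe K. inv_into (universe K) f x)"
  using assms group.m_inv_consistent[OF group_BijGroup subgroup_Aut, of f K]
  by (simp add: Aut_def inv_BijGroup)

lemma Aut_in_PiE: "carrier (Aut K) \<subseteq> (\<Pi>\<^sub>E i\<in>universe K. universe K)"
  by (auto simp: carrier_Aut PiE_def Bij_imp_extensional dest: Bij_imp_funcset)

lemma carrier_Aut_maps: "f \<in> carrier (Aut K) \<Longrightarrow> x \<in> universe K \<Longrightarrow> f x \<in> universe K"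
  using Aut_in_PiE by blast

lemma topspace_Aut: "topspace (Aut_topology K) = carrier (Aut K)"
  using Aut_in_PiE[of K] by (auto simp: Aut_topology_def)

lemma openin_Aut_eval:
  assumes "x \<in> universe K"
  shows "openin (Aut_topology K) {f \<in> carrier (Aut K). f x = y}"
proof (cases "y \<in> universe K")
  case True
  have "continuous_map (Aut_topology K) (discrete_topology (universe K)) (\<lambda>f. f x)"
    unfolding Aut_topology_def
    by (intro continuous_map_from_subtopology continuous_map_product_projection assms)
  then have "openin (Aut_topology K) {f \<in> topspace (Aut_topology K). f x \<in> {y}}"
    by (rule openin_continuous_map_preimage) (use True in simp)
  then show ?thesis by (simp add: topspace_Aut)
next
  case False
  then have "{f \<in> carrier (Aut K). f x = y} = {}"
    using assms carrier_Aut_maps[of _ K x] by blast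
  then show ?thesis by (simp only: openin_empty)
qed

lemma continuous_map_into_Aut:
  assumes "h \<in> topspace Y \<rightarrow> carrier (Aut K)"
    and "\<And>x y. x \<in> universe K \<Longrightarrow> y \<in> universe K \<Longrightarrow> openin Y {p \<in> topspace Y. h p x = y}"
  shows "continuous_map Y (Aut_topology K) h"
proof -
  have "continuous_map Y (discrete_topology (universe K)) (\<lambda>p. h p x)" if x: "x \<in> universe K" for x
    unfolding continuous_map_def
  proof (intro conjI allI impI)
    show "(\<lambda>p. h p x) \<in> topspace Y \<rightarrow> topspace (discrete_topology (universe K))"
    proof
      fix p assume "p \<in> topspace Y"
      then have "h p \<in> (\<Pi>\<^sub>E i\<in>universe K. universe K)" using assms(1) Aut_in_PiE by blast
      then show "h p x \<in> topspace (discrete_topology (universe K))" using x by auto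
    qed
    fix U assume "openin (discrete_topology (universe K)) U"
    then have "U \<subseteq> universe K" by simp
    moreover have "{p \<in> topspace Y. h p x \<in> U} = (\<Union>y\<in>U. {p \<in> topspace Y. h p x = y})" by auto
    ultimately show "openin Y {p \<in> topspace Y. h p x \<in> U}"
      using assms(2) x by (auto intro!: openin_Union)
  qed
  moreover have "h ` topspace Y \<subseteq> extensional (universe K)"
    using assms(1) Aut_in_PiE[of K] by (auto simp: PiE_def)
  ultimately have
    "continuous_map Y (product_topology (\<lambda>_. discrete_topology (universe K)) (universe K)) h"
    by (simp add: continuous_map_componentwise)
  then show ?thesis
    using assms(1) by (simp add: Aut_topology_def continuous_map_in_subtopology)
qed

theorem topological_group_Aut: "topological_group (Aut K) (Aut_topology K)"
  unfolding topological_group_def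
proof (intro conjI group_Aut topspace_Aut)
  let ?G = "carrier (Aut K)"
  show "continuous_map (prod_topology (Aut_topology K) (Aut_topology K)) (Aut_topology K)
     (\<lambda>(g, h). g \<otimes>\<^bsub>Aut K\<^esub> h)"
  proof (rule continuous_map_into_Aut)
    show "(\<lambda>(g, h). g \<otimes>\<^bsub>Aut K\<^esub> h) \<in>
        topspace (prod_topology (Aut_topology K) (Aut_topology K)) \<rightarrow> ?G"
      by (auto simp: topspace_Aut group.is_monoid[OF group_Aut] monoid.m_closed)
    fix x y assume x: "x \<in> universe K" and y: "y \<in> universe K"
    have "{p \<in> topspace (prod_topology (Aut_topology K) (Aut_topology K)).
            (case p of (g, h) \<Rightarrow> g \<otimes>\<^bsub>Aut K\<^esub> h) x = y}
        = (\<Union>z\<in>universe K. {g \<in> ?G. g z = y} \<times> {h \<in> ?G. h x = z})"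
      using x carrier_Aut_maps by (auto simp: topspace_Aut mult_Aut compose_eq)
    also have "openin (prod_topology (Aut_topology K) (Aut_topology K)) \<dots>"
      using x openin_Aut_eval by (auto intro!: openin_Union simp: openin_prod_Times_iff)
    finally show "openin (prod_topology (Aut_topology K) (Aut_topology K))
      {p \<in> topspace (prod_topology (Aut_topology K) (Aut_topology K)).
            (case p of (g, h) \<Rightarrow> g \<otimes>\<^bsub>Aut K\<^esub> h) x = y}" .
  qed
  show "continuous_map (Aut_topology K) (Aut_topology K) (\<lambda>g. inv\<^bsub>Aut K\<^esub> g)"
  proof (rule continuous_map_into_Aut)
    show "(\<lambda>g. inv\<^bsub>Aut K\<^esub> g) \<in> topspace (Aut_topology K) \<rightarrow> ?G"
      by (auto simp: topspace_Aut group.inv_closed[OF group_Aut])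
    fix x y assume x: "x \<in> universe K" and y: "y \<in> universe K"
    have "(inv\<^bsub>Aut K\<^esub> g) x = y \<longleftrightarrow> g y = x" if "g \<in> ?G" for g
    proof -
      have "bij_betw g (universe K) (universe K)" using that by (simp add: carrier_Aut Bij_def)
      then have "inv_into (universe K) g x = y \<longleftrightarrow> g y = x"
        using x y bij_betw_inv_into_left bij_betw_inv_into_right by metis
      then show ?thesis using x that by (simp add: inv_Aut)
    qed
    then have "{g \<in> topspace (Aut_topology K). (inv\<^bsub>Aut K\<^esub> g) x = y} = {g \<in> ?G. g y = x}"
      by (auto simp: topspace_Aut)
    then show "openin (Aut_topology K) {g \<in> topspace (Aut_topology K). (inv\<^bsub>Aut K\<^esub> g) x = y}"
      using openin_Aut_eval[OF y] by simp
  qed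
qed

theorem Hausdorff_space_Aut: "Hausdorff_space (Aut_topology K)"
  unfolding Aut_topology_def
  by (intro Hausdorff_space_subtopology) (simp add: Hausdorff_space_product_topology)

theorem Aut_neighbourhood_of_one:
  "(\<exists>U. openin (Aut_topology K) U \<and> \<one>\<^bsub>Aut K\<^esub> \<in> U \<and> U \<subseteq> W) \<longleftrightarrow>
   (\<exists>A. finite A \<and> A \<subseteq> universe K \<and> {g \<in> carrier (Aut K). \<forall>a\<in>A. g a = a} \<subseteq> W)"
proof
  have one: "\<one>\<^bsub>Aut K\<^esub> = (\<lambda>x\<in>universe K. x)" by (simp add: Aut_def BijGroup_def)
  assume "\<exists>U. openin (Aut_topology K) U \<and> \<one>\<^bsub>Aut K\<^esub> \<in> U \<and> U \<subseteq> W"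
  then obtain V where V: "openin (product_topology (\<lambda>_. discrete_topology (universe K)) (universe K)) V"
    "\<one>\<^bsub>Aut K\<^esub> \<in> V" "V \<inter> carrier (Aut K) \<subseteq> W"
    unfolding Aut_topology_def openin_subtopology by blast
  then obtain B where B: "finite {i \<in> universe K. B i \<noteq> universe K}"
     "\<one>\<^bsub>Aut K\<^esub> \<in> Pi\<^sub>E (universe K) B" "Pi\<^sub>E (universe K) B \<subseteq> V"
    unfolding openin_product_topology_alt by force
  let ?A = "{i \<in> universe K. B i \<noteq> universe K}"
  have sub: "{g \<in> carrier (Aut K). \<forall>a\<in>?A. g a = a} \<subseteq> Pi\<^sub>E (universe K) B"
  proof
    fix g assume g: "g \<in> {g \<in> carrier (Aut K). \<forall>a\<in>?A. g a = a}"
    then have gP: "g \<in> (\<Pi>\<^sub>E i\<in>universe K. universe K)" using Aut_in_PiE by blast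
    show "g \<in> Pi\<^sub>E (universe K) B"
    proof (rule PiE_I)
      fix i assume i: "i \<in> universe K"
      have "i \<in> B i" using B(2) i one by (auto simp: PiE_def Pi_def)
      then show "g i \<in> B i"
        using g gP i by (cases "B i = universe K") auto
    qed (use gP in auto)
  qed
  show "\<exists>A. finite A \<and> A \<subseteq> universe K \<and> {g \<in> carrier (Aut K). \<forall>a\<in>A. g a = a} \<subseteq> W"
  proof (intro exI conjI)
    show "finite ?A" by (fact B(1))
    show "{g \<in> carrier (Aut K). \<forall>a\<in>?A. g a = a} \<subseteq> W"
    proof
      fix g assume g: "g \<in> {g \<in> carrier (Aut K). \<forall>a\<in>?A. g a = a}"
      then have "g \<in> V" using sub B(3) by (meson subsetD)
      moreover have "g \<in> carrier (Aut K)" using g by simp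
      ultimately show "g \<in> W" using V(3) by auto
    qed
  qed simp
next
  have one: "\<one>\<^bsub>Aut K\<^esub> = (\<lambda>x\<in>universe K. x)" by (simp add: Aut_def BijGroup_def)
  have one_in: "\<one>\<^bsub>Aut K\<^esub> \<in> carrier (Aut K)"
    using group_Aut group.is_monoid monoid.one_closed by blast
  assume "\<exists>A. finite A \<and> A \<subseteq> universe K \<and> {g \<in> carrier (Aut K). \<forall>a\<in>A. g a = a} \<subseteq> W"
  then obtain A where A: "finite A" "A \<subseteq> universe K"
    "{g \<in> carrier (Aut K). \<forall>a\<in>A. g a = a} \<subseteq> W" by blast
  have "openin (Aut_topology K) {g \<in> carrier (Aut K). \<forall>a\<in>A. g a = a}"
    using A(1,2)
  proof (induction A rule: finite_induct)
    case empty
    then show ?case using openin_topspace[of "Aut_topology K"] by (simp add: topspace_Aut)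
  next
    case (insert a A)
    have "{g \<in> carrier (Aut K). \<forall>a\<in>insert a A. g a = a} =
      {g \<in> carrier (Aut K). g a = a} \<inter> {g \<in> carrier (Aut K). \<forall>a\<in>A. g a = a}" by auto
    then show ?case using insert openin_Aut_eval[of a K a] by auto
  qed
  moreover have "\<one>\<^bsub>Aut K\<^esub> \<in> {g \<in> carrier (Aut K). \<forall>a\<in>A. g a = a}"
    using one one_in A by auto
  ultimately show "\<exists>U. openin (Aut_topology K) U \<and> \<one>\<^bsub>Aut K\<^esub> \<in> U \<and> U \<subseteq> W"
    using A(3) by blast
qed


section \<open>The directed graph \<open>S(3)\<close>\<close>

definition S3 :: "complex rel_structure" where
  "S3 = \<lparr>universe = range (\<lambda>q::rat. cis (of_rat q)),
         rel = {[cis (of_rat q1), cis (of_rat q2)] | q1 q2 :: rat.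
                  \<exists>m::int. of_rat (q2 - q1) \<in> {2 * pi * m <..< 2 * pi * m + 2 * pi / 3}}\<rparr>"


section \<open>Boron trees\<close>

text \<open>A simple graph is given by its vertex set and a set of two-element sets of vertices.\<close>

definition simple_graph :: "'v set \<Rightarrow> 'v set set \<Rightarrow> bool" where
  "simple_graph V E \<longleftrightarrow> (\<forall>e\<in>E. e \<subseteq> V \<and> card e = 2)"

definition path_between :: "'v set \<Rightarrow> 'v set set \<Rightarrow> 'v \<Rightarrow> 'v list \<Rightarrow> 'v \<Rightarrow> bool" where
  "path_between V E u p v \<longleftrightarrow>
     p \<noteq> [] \<and> hd p = u \<and> last p = v \<and> set p \<subseteq> V \<and> distinct p \<and>
     successively (\<lambda>x y. {x, y} \<in> E) p"

definition is_cycle :: "'v set \<Rightarrow> 'v set set \<Rightarrow> 'v list \<Rightarrow> bool" where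
  "is_cycle V E p \<longleftrightarrow>
     length p \<ge> 3 \<and> set p \<subseteq> V \<and> distinct p \<and>
     successively (\<lambda>x y. {x, y} \<in> E) p \<and> {last p, hd p} \<in> E"

definition is_tree :: "'v set \<Rightarrow> 'v set set \<Rightarrow> bool" where
  "is_tree V E \<longleftrightarrow>
     simple_graph V E \<and> V \<noteq> {} \<and>
     (\<forall>u\<in>V. \<forall>v\<in>V. \<exists>p. path_between V E u p v) \<and>
     (\<nexists>p. is_cycle V E p)"

definition vertex_degree :: "'v set set \<Rightarrow> 'v \<Rightarrow> nat" where
  "vertex_degree E v = card {e\<in>E. v \<in> e}"

definition boron_tree :: "'v set \<Rightarrow> 'v set set \<Rightarrow> bool" where
  "boron_tree V E \<longleftrightarrow> is_tree V E \<and> (\<forall>v\<in>V. vertex_degree E v \<in> {1, 3})"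

definition leaves :: "'v set \<Rightarrow> 'v set set \<Rightarrow> 'v set" where
  "leaves V E = {v\<in>V. vertex_degree E v = 1}"

text \<open>Paths in a tree are unique, so the existential quantifier speaks about the two paths.\<close>

definition leaf_structure :: "'v set \<Rightarrow> 'v set set \<Rightarrow> 'v rel_structure" where
  "leaf_structure V E =
     \<lparr>universe = leaves V E,
      rel = {[a, b, c, d] | a b c d.
               {a, b, c, d} \<subseteq> leaves V E \<and> distinct [a, b, c, d] \<and>
               (\<exists>p q. path_between V E a p b \<and> path_between V E c q d \<and> set p \<inter> set q = {})}\<rparr>"

text \<open>
  Finite structures are considered up to isomorphism, so it suffices to take them, and the trees
  presenting them, on natural numbers.
\<close>

definition boron_class :: "nat rel_structure set" where
  "boron_class =
     {C. well_formed C \<and>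
         ((\<exists>(V :: nat set) E. finite V \<and> boron_tree V E \<and> isomorphic (leaf_structure V E) C) \<or>
          (\<exists>x. C = \<lparr>universe = {x}, rel = {}\<rparr>))}"


section \<open>Fraisse limits\<close>

text \<open>As usual for relational structures, the empty structure is not counted.\<close>

definition age :: "'a rel_structure \<Rightarrow> nat rel_structure set" where
  "age K =
     {C. well_formed C \<and>
         (\<exists>A. A \<subseteq> universe K \<and> finite A \<and> A \<noteq> {} \<and> isomorphic (substructure K A) C)}"

definition ultrahomogeneous :: "'a rel_structure \<Rightarrow> bool" where
  "ultrahomogeneous K \<longleftrightarrow>
     (\<forall>A B f. A \<subseteq> universe K \<and> B \<subseteq> universe K \<and> finite A \<and> finite B \<and>
              is_isomorphism f (substructure K A) (substructure K B) \<longrightarrow>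
              (\<exists>g\<in>carrier (Aut K). \<forall>x\<in>A. g x = f x))"

definition is_Fraisse_limit :: "'a rel_structure \<Rightarrow> nat rel_structure set \<Rightarrow> bool" where
  "is_Fraisse_limit K \<C> \<longleftrightarrow>
     well_formed K \<and> countable (universe K) \<and> infinite (universe K) \<and>
     ultrahomogeneous K \<and> age K = \<C>"

end

theory Submission
  imports Defs
begin

text \<open>
  Let \<open>K\<close> be a structure and \<open>S\<^sub>0\<close> any relation on it. The closure of the orbit of \<open>S\<^sub>0\<close>
  under \<open>Aut K\<close>, inside the compact space of all relations, is a flow. If \<open>Aut K\<close> is amenable,
  this flow carries an invariant probability measure, that is, there is a random relation \<open>S\<close> whose
  law is invariant and which on every finite set of tuples looks like a translate of \<open>S\<^sub>0\<close>
  (\<open>amenable_imp_invariant_random_relation\<close>). For both structures a suitable \<open>S\<^sub>0\<close> makes such an \<open>S\<close>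
  impossible for reasons of counting.

  For \<open>\<^bold>T\<close>, fix a leaf \<open>e\<close>, and let \<open>S\<^sub>0\<close> hold of \<open>(a, b, c)\<close> if \<open>e\<close> hangs on the branch of \<open>a\<close> in the
  tripod spanned by \<open>a\<close>, \<open>b\<close> and \<open>c\<close>. The group is transitive on triples of distinct leaves, so
  \<open>S (a, b, c)\<close> has the same probability \<open>m\<close> for all of them, and \<open>3 m \<ge> 1\<close> because \<open>e\<close> hangs on one
  of the three branches. If the path from \<open>a\<close> to \<open>b\<close> avoids the path from \<open>c\<close> to \<open>d\<close>, then the four
  pendant branches of the tree spanned by these leaves exclude one another, and \<open>4 m \<le> 1\<close>. What this
  uses about boron trees is collected in the locale \<open>quartet_structure\<close>; it follows from the
  observation that two paths in a tree are disjoint exactly if deleting some edge separates them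
  (\<open>separated_iff_disjoint_paths\<close>).

  For \<open>\<^bold>S(3)\<close>, let \<open>S\<^sub>0\<close> be a half-open arc of length \<open>2 \<pi> / 3\<close>. For vertices \<open>u, v, w\<close> in this order on
  an arc shorter than \<open>2 \<pi> / 3\<close>, at most one of the pairs \<open>u, v\<close> and \<open>v, w\<close> is separated by \<open>S\<close>, so the
  probabilities of separation add up along such an arc. For the vertices at the angles \<open>0, 1, 2\<close> some
  automorphism fixes \<open>u\<close> and moves \<open>v\<close> to \<open>w\<close> (\<open>S3_stretch\<close>), which forces the probability that \<open>S\<close>
  separates \<open>v\<close> from \<open>w\<close> to be zero. By rotation the same holds for any two vertices one radian apart.
  Going around the circle through the angles \<open>0, 1, \<dots>, 6\<close>, \<open>S\<close> almost surely contains all or none of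
  them. But \<open>S\<^sub>0\<close> and its complement both meet every closed directed walk
  (\<open>closed_walk_meets_base_arc\<close>).
\<close>

section \<open>Invariant random relations\<close>

text \<open>
  The closure of the orbit of \<open>S\<^sub>0\<close> in the space of relations of all arities, a relation being
  encoded by its characteristic function, which is \<open>undefined\<close> outside the tuples of \<open>K\<close>. Spelling out
  the closure by finite sets of tuples makes it evident that a property of finitely many tuples passes
  from the translates of \<open>S\<^sub>0\<close> to every point.
\<close>
definition orbit_closure :: "'a rel_structure \<Rightarrow> 'a list set \<Rightarrow> ('a list \<Rightarrow> bool) set" where
  "orbit_closure K S\<^sub>0 =
     {S \<in> (\<Pi>\<^sub>E xs\<in>lists (universe K). UNIV).
        \<forall>F. finite F \<and> F \<subseteq> lists (universe K) \<longrightarrow>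
          (\<exists>g\<in>carrier (Aut K). \<forall>xs\<in>F. S xs \<longleftrightarrow> map g xs \<in> S\<^sub>0)}"

lemma orbit_closureD:
  assumes "S \<in> orbit_closure K S\<^sub>0" "finite F" "F \<subseteq> lists (universe K)"
  shows "\<exists>g\<in>carrier (Aut K). \<forall>xs\<in>F. S xs \<longleftrightarrow> map g xs \<in> S\<^sub>0"
  using assms unfolding orbit_closure_def by simp

definition relation_topology :: "'a rel_structure \<Rightarrow> ('a list \<Rightarrow> bool) topology" where
  "relation_topology K = product_topology (\<lambda>_. discrete_topology UNIV) (lists (universe K))"

definition pull_back :: "'a rel_structure \<Rightarrow> ('a \<Rightarrow> 'a) \<Rightarrow> ('a list \<Rightarrow> bool) \<Rightarrow> 'a list \<Rightarrow> bool" where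
  "pull_back K g S = (\<lambda>xs\<in>lists (universe K). S (map g xs))"

lemma map_Aut_lists:
  assumes "g \<in> carrier (Aut K)" "xs \<in> lists (universe K)"
  shows "map g xs \<in> lists (universe K)"
  using assms carrier_Aut_maps[OF assms(1)] by (auto simp: lists_eq_set)

lemma map_Aut_rel:
  assumes "g \<in> carrier (Aut K)" "xs \<in> lists (universe K)"
  shows "map g xs \<in> rel K \<longleftrightarrow> xs \<in> rel K"
  using assms by (auto simp: carrier_Aut is_isomorphism_def)

lemma map_mult_Aut:
  assumes "g \<in> carrier (Aut K)" "h \<in> carrier (Aut K)" "xs \<in> lists (universe K)"
  shows "map (g \<otimes>\<^bsub>Aut K\<^esub> h) xs = map g (map h xs)"
  using assms by (auto simp: mult_Aut compose_eq lists_eq_set)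

lemma map_one_Aut:
  assumes "xs \<in> lists (universe K)"
  shows "map \<one>\<^bsub>Aut K\<^esub> xs = xs"
proof -
  have "\<one>\<^bsub>Aut K\<^esub> = (\<lambda>x\<in>universe K. x)" by (simp add: Aut_def BijGroup_def)
  then show ?thesis using assms by (intro map_idI) (auto simp: lists_eq_set)
qed

lemma map_inv_Aut:
  assumes "g \<in> carrier (Aut K)" "xs \<in> lists (universe K)"
  shows "map (inv\<^bsub>Aut K\<^esub> g) (map g xs) = xs"
  using assms map_mult_Aut[of "inv\<^bsub>Aut K\<^esub> g" K g xs] map_one_Aut[of xs K]
    group.l_inv[OF group_Aut] group.inv_closed[OF group_Aut] by metis

lemma topspace_relation_topology:
  "topspace (relation_topology K) = (\<Pi>\<^sub>E xs\<in>lists (universe K). UNIV)"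
  by (simp add: relation_topology_def)

lemma openin_relation_eval:
  assumes "xs \<in> lists (universe K)"
  shows "openin (relation_topology K) {S \<in> topspace (relation_topology K). S xs = b}"
proof -
  have "continuous_map (relation_topology K) (discrete_topology UNIV) (\<lambda>S. S xs)"
    unfolding relation_topology_def by (intro continuous_map_product_projection assms)
  then have "openin (relation_topology K) {S \<in> topspace (relation_topology K). S xs \<in> {b}}"
    by (rule openin_continuous_map_preimage) simp
  then show ?thesis by simp
qed

lemma openin_relation_agree:
  assumes "finite F" "F \<subseteq> lists (universe K)"
  shows "openin (relation_topology K) {S \<in> topspace (relation_topology K). \<forall>xs\<in>F. S xs = S' xs}"
  using assms
proof (induction F rule: finite_induct)
  case empty
  then show ?case using openin_topspace[of "relation_topology K"] by simp
next
  case (insert xs F)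
  have "{S \<in> topspace (relation_topology K). \<forall>ys\<in>insert xs F. S ys = S' ys} =
    {S \<in> topspace (relation_topology K). S xs = S' xs} \<inter>
    {S \<in> topspace (relation_topology K). \<forall>ys\<in>F. S ys = S' ys}" by blast
  then show ?case using insert openin_relation_eval[of xs K "S' xs"] by auto
qed

text \<open>
  A finite set of tuples that witnesses that \<open>S\<close> is not in the closure does so for all relations that
  agree with \<open>S\<close> on it.
\<close>
lemma closedin_orbit_closure: "closedin (relation_topology K) (orbit_closure K S\<^sub>0)"
  unfolding closedin_def
proof
  let ?T = "topspace (relation_topology K)"
  show "orbit_closure K S\<^sub>0 \<subseteq> ?T"
    by (auto simp: orbit_closure_def topspace_relation_topology)
  show "openin (relation_topology K) (?T - orbit_closure K S\<^sub>0)"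
    unfolding openin_subopen[of _ "?T - orbit_closure K S\<^sub>0"]
  proof
    fix S assume S: "S \<in> ?T - orbit_closure K S\<^sub>0"
    then obtain F where F: "finite F" "F \<subseteq> lists (universe K)"
      "\<not> (\<exists>g\<in>carrier (Aut K). \<forall>xs\<in>F. S xs \<longleftrightarrow> map g xs \<in> S\<^sub>0)"
      by (auto simp: orbit_closure_def topspace_relation_topology)
    let ?U = "{S' \<in> ?T. \<forall>xs\<in>F. S' xs = S xs}"
    have "?U \<inter> orbit_closure K S\<^sub>0 = {}"
    proof -
      have False if S': "S' \<in> ?U" "S' \<in> orbit_closure K S\<^sub>0" for S'
      proof -
        obtain g where "g \<in> carrier (Aut K)" "\<forall>xs\<in>F. S' xs \<longleftrightarrow> map g xs \<in> S\<^sub>0"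
          using orbit_closureD[OF S'(2) F(1,2)] by blast
        then show False using S'(1) F(3) by auto
      qed
      then show ?thesis by blast
    qed
    then show "\<exists>U. openin (relation_topology K) U \<and> S \<in> U \<and> U \<subseteq> ?T - orbit_closure K S\<^sub>0"
      using openin_relation_agree[OF F(1,2), of S] S by (intro exI[of _ ?U]) auto
  qed
qed

lemma pull_back_orbit_closure:
  assumes g: "g \<in> carrier (Aut K)" and S: "S \<in> orbit_closure K S\<^sub>0"
  shows "pull_back K g S \<in> orbit_closure K S\<^sub>0"
  unfolding orbit_closure_def
proof (intro CollectI conjI allI impI)
  show "pull_back K g S \<in> (\<Pi>\<^sub>E xs\<in>lists (universe K). UNIV)" by (simp add: pull_back_def)
  fix F assume F: "finite F \<and> F \<subseteq> lists (universe K)"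
  then have "finite (map g ` F)" "map g ` F \<subseteq> lists (universe K)"
    using map_Aut_lists[OF g] by blast+
  from orbit_closureD[OF S this] obtain h
    where h: "h \<in> carrier (Aut K)" "\<forall>ys\<in>map g ` F. S ys \<longleftrightarrow> map h ys \<in> S\<^sub>0" by blast
  have "pull_back K g S xs \<longleftrightarrow> map (h \<otimes>\<^bsub>Aut K\<^esub> g) xs \<in> S\<^sub>0" if "xs \<in> F" for xs
  proof -
    have "xs \<in> lists (universe K)" using that F by blast
    then show ?thesis
      using h(2) that map_mult_Aut[OF h(1) g]
      by (simp add: pull_back_def del: in_lists_conv_set map_map)
  qed
  moreover have "h \<otimes>\<^bsub>Aut K\<^esub> g \<in> carrier (Aut K)"
    using g h(1) group.is_monoid[OF group_Aut] monoid.m_closed by fastforce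
  ultimately show "\<exists>h\<in>carrier (Aut K). \<forall>xs\<in>F. pull_back K g S xs \<longleftrightarrow> map h xs \<in> S\<^sub>0" by blast
qed

lemma pull_back_pull_back:
  assumes "g \<in> carrier (Aut K)" "h \<in> carrier (Aut K)"
  shows "pull_back K g (pull_back K h S) = pull_back K (h \<otimes>\<^bsub>Aut K\<^esub> g) S"
  unfolding pull_back_def
  by (rule restrict_ext)
    (use assms in \<open>simp add: map_mult_Aut map_Aut_lists del: in_lists_conv_set map_map\<close>)

lemma pull_back_one:
  assumes "S \<in> (\<Pi>\<^sub>E xs\<in>lists (universe K). UNIV)"
  shows "pull_back K \<one>\<^bsub>Aut K\<^esub> S = S"
proof
  fix xs show "pull_back K \<one>\<^bsub>Aut K\<^esub> S xs = S xs"
  proof (cases "xs \<in> lists (universe K)")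
    case True
    then show ?thesis by (simp add: pull_back_def map_one_Aut del: in_lists_conv_set)
  next
    case False
    then show ?thesis using PiE_arb[OF assms False] by (simp add: pull_back_def del: in_lists_conv_set)
  qed
qed

lemma openin_Aut_map:
  assumes "xs \<in> lists (universe K)"
  shows "openin (Aut_topology K) {g \<in> carrier (Aut K). map g xs = ys}"
  using assms
proof (induction xs arbitrary: ys rule: list.induct)
  case Nil
  then show ?case
    using openin_topspace[of "Aut_topology K"] by (cases ys) (auto simp: topspace_Aut)
next
  case (Cons x xs)
  have x: "x \<in> universe K" and xs: "xs \<in> lists (universe K)" using Cons.prems by auto
  show ?case
  proof (cases ys)
    case (Cons z zs)
    have "{g \<in> carrier (Aut K). map g (x # xs) = ys} =
      {g \<in> carrier (Aut K). g x = z} \<inter> {g \<in> carrier (Aut K). map g xs = zs}"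
      using Cons by auto
    moreover have "openin (Aut_topology K) \<dots>"
      using openin_Aut_eval[OF x] Cons.IH[OF xs] by (rule openin_Int)
    ultimately show ?thesis by (simp only:)
  qed simp
qed

text \<open>
  Pulling back is contravariant in the automorphism; the inverse turns it into a left action.
\<close>
definition translation ::
  "'a rel_structure \<Rightarrow> 'a list set \<Rightarrow> ('a \<Rightarrow> 'a) \<Rightarrow> ('a list \<Rightarrow> bool) \<Rightarrow> 'a list \<Rightarrow> bool" where
  "translation K S\<^sub>0 g = (\<lambda>S\<in>orbit_closure K S\<^sub>0. pull_back K (inv\<^bsub>Aut K\<^esub> g) S)"

text \<open>
  The value of \<open>g S\<close> at \<open>xs\<close> is the value of \<open>S\<close> at some \<open>ys\<close> with \<open>g ys = xs\<close>. For each fixed \<open>ys\<close> both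
  \<open>g ys = xs\<close> and the value of \<open>S\<close> at \<open>ys\<close> are open conditions, which gives joint continuity.
\<close>
lemma continuous_action_translation:
  "continuous_action (Aut K) (Aut_topology K)
     (subtopology (relation_topology K) (orbit_closure K S\<^sub>0)) (translation K S\<^sub>0)"
proof -
  let ?G = "Aut K" and ?X = "orbit_closure K S\<^sub>0"
  let ?T = "subtopology (relation_topology K) ?X"
  interpret G: group ?G by (rule group_Aut)
  have XP: "?X \<subseteq> (\<Pi>\<^sub>E xs\<in>lists (universe K). UNIV)" by (auto simp: orbit_closure_def)
  have topX: "topspace ?T = ?X" using XP by (auto simp: topspace_relation_topology)
  have inX: "translation K S\<^sub>0 g S \<in> ?X" if "g \<in> carrier ?G" "S \<in> ?X" for g S
    using that pull_back_orbit_closure[of "inv\<^bsub>?G\<^esub> g" K S S\<^sub>0] by (simp add: translation_def)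
  have mult: "translation K S\<^sub>0 (g \<otimes>\<^bsub>?G\<^esub> h) S = translation K S\<^sub>0 g (translation K S\<^sub>0 h S)"
    if "g \<in> carrier ?G" "h \<in> carrier ?G" "S \<in> ?X" for g h S
    using that inX[of h S] pull_back_pull_back[of "inv\<^bsub>?G\<^esub> g" K "inv\<^bsub>?G\<^esub> h" S]
    by (simp add: translation_def G.inv_mult_group)
  have one: "translation K S\<^sub>0 \<one>\<^bsub>?G\<^esub> S = S" if "S \<in> ?X" for S
    using that pull_back_one[of S K] XP by (auto simp: translation_def)
  have bij: "translation K S\<^sub>0 g \<in> Bij ?X" if g: "g \<in> carrier ?G" for g
  proof -
    have "translation K S\<^sub>0 (inv\<^bsub>?G\<^esub> g) (translation K S\<^sub>0 g S) = S" "translation K S\<^sub>0 g (translation K S\<^sub>0 (inv\<^bsub>?G\<^esub> g) S) = S" if "S \<in> ?X" for S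
      using that g one[OF that] mult[of "inv\<^bsub>?G\<^esub> g" g S] mult[of g "inv\<^bsub>?G\<^esub> g" S] by auto
    then have "bij_betw (translation K S\<^sub>0 g) ?X ?X"
      using inX g by (intro bij_betw_byWitness[where f' = "translation K S\<^sub>0 (inv\<^bsub>?G\<^esub> g)"]) auto
    then show ?thesis by (simp add: Bij_def translation_def)
  qed
  have act: "group_action ?G ?X (translation K S\<^sub>0)"
    unfolding group_action_def group_hom_def group_hom_axioms_def
  proof (intro conjI group_BijGroup homI G.group_axioms)
    fix g h assume g: "g \<in> carrier ?G" and h: "h \<in> carrier ?G"
    show "translation K S\<^sub>0 g \<in> carrier (BijGroup ?X)" using bij g by (simp add: BijGroup_def)
    have "translation K S\<^sub>0 (g \<otimes>\<^bsub>?G\<^esub> h) S = compose ?X (translation K S\<^sub>0 g) (translation K S\<^sub>0 h) S" for S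
    proof (cases "S \<in> ?X")
      case True
      then show ?thesis using mult[OF g h True] by (simp add: compose_eq)
    qed (simp add: translation_def compose_def)
    then show "translation K S\<^sub>0 (g \<otimes>\<^bsub>?G\<^esub> h) = translation K S\<^sub>0 g \<otimes>\<^bsub>BijGroup ?X\<^esub> translation K S\<^sub>0 h"
      using bij g h by (auto simp: BijGroup_def)
  qed
  define P where "P = prod_topology (Aut_topology K) ?T"
  have topP: "p \<in> topspace P \<longleftrightarrow> fst p \<in> carrier ?G \<and> snd p \<in> ?X" for p
    unfolding P_def topspace_prod_topology topX topspace_Aut by (rule mem_Times_iff)
  have coord: "continuous_map P (discrete_topology UNIV) (\<lambda>p. translation K S\<^sub>0 (fst p) (snd p) xs)"
    if xs: "xs \<in> lists (universe K)" for xs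
  unfolding continuous_map_def
  proof (intro conjI allI impI)
    fix B :: "bool set"
    define V where "V ys = {g \<in> carrier ?G. map g ys = xs}" for ys
    define W where "W ys = {S \<in> ?X. S ys \<in> B}" for ys
    have V: "openin (Aut_topology K) (V ys)" if "ys \<in> lists (universe K)" for ys
      unfolding V_def by (rule openin_Aut_map[OF that])
    have W: "openin ?T (W ys)" if ys: "ys \<in> lists (universe K)" for ys
    proof -
      have "W ys = (\<Union>b\<in>B. {S \<in> topspace (relation_topology K). S ys = b}) \<inter> ?X"
        using XP by (auto simp: W_def topspace_relation_topology)
      moreover have "openin (relation_topology K)
          (\<Union>b\<in>B. {S \<in> topspace (relation_topology K). S ys = b})"
        using openin_relation_eval[OF ys] by (intro openin_Union) auto
      ultimately show ?thesis unfolding openin_subtopology by blast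
    qed
    define L where "L = {p \<in> topspace P. translation K S\<^sub>0 (fst p) (snd p) xs \<in> B}"
    have "L = (\<Union>ys\<in>lists (universe K). V ys \<times> W ys)"
    proof (intro equalityI subsetI)
      fix p assume p: "p \<in> L"
      let ?ys = "map (inv\<^bsub>?G\<^esub> (fst p)) xs"
      have g: "fst p \<in> carrier ?G" "snd p \<in> ?X" using p by (simp_all add: L_def topP)
      then have ig: "inv\<^bsub>?G\<^esub> (fst p) \<in> carrier ?G" by simp
      have "map (fst p) ?ys = xs"
        using map_inv_Aut[OF ig xs] G.inv_inv[OF g(1)] by (simp only:)
      moreover have ys: "?ys \<in> lists (universe K)" by (rule map_Aut_lists[OF ig xs])
      moreover have "snd p ?ys \<in> B"
        using p g xs unfolding L_def translation_def pull_back_def by (simp del: map_map in_lists_conv_set)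
      ultimately have "p \<in> V ?ys \<times> W ?ys"
        using g unfolding V_def W_def by (simp add: mem_Times_iff del: map_map)
      then show "p \<in> (\<Union>ys\<in>lists (universe K). V ys \<times> W ys)" using ys by blast
    next
      fix p assume "p \<in> (\<Union>ys\<in>lists (universe K). V ys \<times> W ys)"
      then obtain ys where ys: "ys \<in> lists (universe K)" "fst p \<in> carrier ?G" "map (fst p) ys = xs"
        "snd p \<in> ?X" "snd p ys \<in> B"
        unfolding V_def W_def mem_Times_iff UN_iff mem_Collect_eq by blast
      then have "map (inv\<^bsub>?G\<^esub> (fst p)) xs = ys" using map_inv_Aut[of "fst p" K ys] by simp
      then show "p \<in> L"
        using ys(2,4,5) xs
        by (simp add: L_def topP translation_def pull_back_def del: in_lists_conv_set)
    qed
    moreover have "openin P (\<Union>ys\<in>lists (universe K). V ys \<times> W ys)"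
    proof (rule openin_Union)
      fix Z assume "Z \<in> (\<lambda>ys. V ys \<times> W ys) ` lists (universe K)"
      then obtain ys where "ys \<in> lists (universe K)" and Z: "Z = V ys \<times> W ys" by (rule imageE)
      then show "openin P Z"
        unfolding Z P_def openin_prod_Times_iff using V W by blast
    qed
    ultimately have "openin P L" by simp
    then show "openin P {p \<in> topspace P. translation K S\<^sub>0 (fst p) (snd p) xs \<in> B}"
      unfolding L_def .
  qed simp
  have into: "translation K S\<^sub>0 (fst p) (snd p) \<in> ?X" if "p \<in> topspace P" for p
    using that inX topP by blast
  then have "translation K S\<^sub>0 (fst p) (snd p) \<in> extensional (lists (universe K))"
    if "p \<in> topspace P" for p
    using that XP unfolding PiE_def by blast
  then have "continuous_map P (relation_topology K) (\<lambda>p. translation K S\<^sub>0 (fst p) (snd p))"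
    using coord unfolding relation_topology_def continuous_map_componentwise by blast
  then have "continuous_map P ?T (\<lambda>p. translation K S\<^sub>0 (fst p) (snd p))"
    using into unfolding continuous_map_in_subtopology by blast
  then show ?thesis using act
    unfolding continuous_action_def P_def[symmetric] topX case_prod_unfold by blast
qed

text \<open>
  The measure is the invariant measure on the orbit closure of \<open>S\<^sub>0\<close>; the last property is how facts
  about \<open>S\<^sub>0\<close> are transferred to its points.
\<close>
theorem amenable_imp_invariant_random_relation:
  assumes amen: "amenable (Aut K) (Aut_topology K)"
  obtains M :: "('a list \<Rightarrow> bool) measure" where "prob_space M"
    "\<And>xs. xs \<in> lists (universe K) \<Longrightarrow> {S \<in> space M. S xs} \<in> sets M"
    "\<And>g A. g \<in> carrier (Aut K) \<Longrightarrow> A \<in> sets M \<Longrightarrow>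
       measure M {S \<in> space M. pull_back K g S \<in> A} = measure M A"
    "\<And>g S. g \<in> carrier (Aut K) \<Longrightarrow> S \<in> space M \<Longrightarrow> pull_back K g S \<in> space M"
    "\<And>S F. S \<in> space M \<Longrightarrow> finite F \<Longrightarrow> F \<subseteq> lists (universe K) \<Longrightarrow>
       \<exists>g\<in>carrier (Aut K). \<forall>xs\<in>F. S xs \<longleftrightarrow> map g xs \<in> S\<^sub>0"
proof -
  let ?G = "Aut K" and ?X = "orbit_closure K S\<^sub>0"
  let ?T = "subtopology (relation_topology K) ?X"
  interpret G: group ?G by (rule group_Aut)
  have topX: "topspace ?T = ?X"
    by (auto simp: topspace_relation_topology orbit_closure_def)
  have "compact_space (relation_topology K)"
    unfolding relation_topology_def
    by (subst compact_space_product_topology) (auto simp: compact_space_discrete_topology)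
  then have 1: "compact_space ?T"
    using closedin_compact_space closedin_orbit_closure compact_space_subtopology by blast
  have 2: "Hausdorff_space ?T"
    unfolding relation_topology_def
    by (intro Hausdorff_space_subtopology) (simp add: Hausdorff_space_product_topology)
  have "(\<lambda>xs\<in>lists (universe K). xs \<in> S\<^sub>0) \<in> ?X"
    unfolding orbit_closure_def
  proof (intro CollectI conjI allI impI)
    fix F assume F: "finite F \<and> F \<subseteq> lists (universe K)"
    then have "(\<lambda>xs\<in>lists (universe K). xs \<in> S\<^sub>0) xs \<longleftrightarrow> map \<one>\<^bsub>?G\<^esub> xs \<in> S\<^sub>0" if "xs \<in> F" for xs
      using that map_one_Aut[of xs K] by auto
    then show "\<exists>g\<in>carrier ?G. \<forall>xs\<in>F. (\<lambda>xs\<in>lists (universe K). xs \<in> S\<^sub>0) xs \<longleftrightarrow> map g xs \<in> S\<^sub>0"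
      by (meson G.one_closed)
  qed simp
  then have 3: "topspace ?T \<noteq> {}" using topX by blast
  obtain M where M: "borel_probability_measure ?T M" "invariant_measure ?G (translation K S\<^sub>0) M"
    using amenable_any_type[OF topspace_Aut amen 1 2 3 continuous_action_translation] by blast
  have sp: "space M = ?X" and sets: "sets M = sigma_sets (topspace ?T) {U. openin ?T U}"
    and prob: "prob_space M" using M(1) topX by (auto simp: borel_probability_measure_def)
  show ?thesis
  proof
    show "prob_space M" by (fact prob)
    fix xs assume xs: "xs \<in> lists (universe K)"
    have "{S \<in> space M. S xs} = {S \<in> topspace (relation_topology K). S xs = True} \<inter> ?X"
      unfolding sp by (auto simp: topspace_relation_topology orbit_closure_def)
    then have "openin ?T {S \<in> space M. S xs}"
      using openin_relation_eval[OF xs, of True] openin_subtopology by blast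
    then show "{S \<in> space M. S xs} \<in> sets M" using sets by auto
  next
    fix g A assume g: "g \<in> carrier ?G" and A: "A \<in> sets M"
    have ig: "inv\<^bsub>?G\<^esub> g \<in> carrier ?G" using g by simp
    have "continuous_map ?T (prod_topology (Aut_topology K) ?T) (\<lambda>S. (inv\<^bsub>?G\<^esub> g, S))"
      using ig by (simp add: continuous_map_pairedI topspace_Aut)
    moreover have "continuous_map (prod_topology (Aut_topology K) ?T) ?T (\<lambda>(g, S). translation K S\<^sub>0 g S)"
      using continuous_action_translation[of K S\<^sub>0] by (simp add: continuous_action_def)
    ultimately have "continuous_map ?T ?T ((\<lambda>(g, S). translation K S\<^sub>0 g S) \<circ> (\<lambda>S. (inv\<^bsub>?G\<^esub> g, S)))"
      by (rule continuous_map_compose)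
    then have "continuous_map ?T ?T (translation K S\<^sub>0 (inv\<^bsub>?G\<^esub> g))" unfolding o_def split_conv .
    then have meas: "translation K S\<^sub>0 (inv\<^bsub>?G\<^esub> g) \<in> measurable M M"
      by (rule continuous_map_borel_measurable) (simp_all only: sp sets topX)
    have "measure M A = measure (distr M M (translation K S\<^sub>0 (inv\<^bsub>?G\<^esub> g))) A"
      using M(2) ig by (simp add: invariant_measure_def)
    also have "\<dots> = measure M (translation K S\<^sub>0 (inv\<^bsub>?G\<^esub> g) -` A \<inter> space M)"
      by (rule measure_distr[OF meas A])
    also have "translation K S\<^sub>0 (inv\<^bsub>?G\<^esub> g) -` A \<inter> space M = {S \<in> space M. pull_back K g S \<in> A}"
      using g by (auto simp: sp translation_def)
    finally show "measure M {S \<in> space M. pull_back K g S \<in> A} = measure M A" by simp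
  next
    fix g S assume "g \<in> carrier ?G" "S \<in> space M"
    then show "pull_back K g S \<in> space M" using pull_back_orbit_closure sp by blast
  next
    fix S F assume "S \<in> space M" "finite F" "F \<subseteq> lists (universe K)"
    then show "\<exists>g\<in>carrier ?G. \<forall>xs\<in>F. S xs \<longleftrightarrow> map g xs \<in> S\<^sub>0"
      unfolding sp by (rule orbit_closureD)
  qed
qed

section \<open>Half-trees and the splits of a tree\<close>

definition adjacency :: "'v set set \<Rightarrow> ('v \<times> 'v) set" where
  "adjacency E = {(u, v). {u, v} \<in> E}"

text \<open>
  The component of \<open>y\<close> that remains when the edge between \<open>x\<close> and \<open>y\<close> is deleted. Reading all
  betweenness in a tree off these sets avoids manipulating the paths themselves.
\<close>
definition half_tree :: "'v set set \<Rightarrow> 'v \<Rightarrow> 'v \<Rightarrow> 'v set" where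
  "half_tree E x y = {v. (y, v) \<in> (adjacency E - {(x, y), (y, x)})\<^sup>*}"

lemma rtrancl_imp_distinct_path:
  assumes "(u, v) \<in> r\<^sup>*"
  shows "\<exists>p. p \<noteq> [] \<and> hd p = u \<and> last p = v \<and> distinct p \<and>
    successively (\<lambda>x y. (x, y) \<in> r) p \<and> set p \<subseteq> r\<^sup>* `` {u}"
  using assms
proof (induction rule: rtrancl_induct)
  case base
  show ?case by (intro exI[of _ "[u]"]) auto
next
  case (step v w)
  then obtain p where p: "p \<noteq> []" "hd p = u" "last p = v" "distinct p"
    "successively (\<lambda>x y. (x, y) \<in> r) p" "set p \<subseteq> r\<^sup>* `` {u}" by blast
  show ?case
  proof (cases "w \<in> set p")
    case True
    then obtain p1 p2 where split: "p = p1 @ w # p2" by (meson split_list)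
    have "successively (\<lambda>x y. (x, y) \<in> r) (p1 @ [w])"
      using p(5) unfolding split by (auto simp: successively_append_iff)
    moreover have "hd (p1 @ [w]) = u" using p(2) unfolding split by (cases p1) auto
    ultimately show ?thesis
      using p(4,6) unfolding split by (intro exI[of _ "p1 @ [w]"]) auto
  next
    case False
    have "(u, w) \<in> r\<^sup>*" using step by auto
    then show ?thesis
      using p False step(2) by (intro exI[of _ "p @ [w]"]) (auto simp: successively_append_iff)
  qed
qed

lemma successively_imp_rtrancl:
  assumes "successively (\<lambda>x y. (x, y) \<in> r) p" "v \<in> set p"
  shows "(hd p, v) \<in> r\<^sup>*"
  using assms
proof (induction p)
  case (Cons x p)
  show ?case
  proof (cases "v = x")
    case False
    then have v: "v \<in> set p" using Cons.prems(2) by simp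
    then have "p \<noteq> []" by auto
    then have "(x, hd p) \<in> r" "successively (\<lambda>x y. (x, y) \<in> r) p"
      using Cons.prems(1) by (auto simp: successively_Cons)
    then show ?thesis using Cons.IH v by (simp add: converse_rtrancl_into_rtrancl)
  qed simp
qed simp

locale tree =
  fixes V :: "'v set" and E :: "'v set set"
  assumes tree: "is_tree V E"
begin

lemma edge: assumes "{x, y} \<in> E" shows "x \<in> V" "y \<in> V" "x \<noteq> y"
proof -
  have "{x, y} \<subseteq> V" "card {x, y} = 2"
    using tree assms by (auto simp: is_tree_def simple_graph_def)
  then show "x \<in> V" "y \<in> V" "x \<noteq> y" by (auto simp: card_insert_if split: if_splits)
qed

lemma sym_without_edge: "sym (adjacency E - {(x, y), (y, x)})"
  by (auto simp: sym_def adjacency_def insert_commute)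

lemma half_tree_refl: "y \<in> half_tree E x y"
  by (simp add: half_tree_def)

lemma half_tree_step:
  assumes "v \<in> half_tree E x y" "{v, w} \<in> E" "{v, w} \<noteq> {x, y}"
  shows "w \<in> half_tree E x y"
proof -
  have "(v, w) \<in> adjacency E - {(x, y), (y, x)}" using assms(2,3) by (auto simp: adjacency_def)
  then show ?thesis using assms(1) unfolding half_tree_def by (auto intro: rtrancl_into_rtrancl)
qed

lemma half_tree_induct [consumes 1, case_names root step]:
  assumes "v \<in> half_tree E x y" and root: "P y"
    and step: "\<And>v w. v \<in> half_tree E x y \<Longrightarrow> {v, w} \<in> E \<Longrightarrow> {v, w} \<noteq> {x, y} \<Longrightarrow> P v \<Longrightarrow> P w"
  shows "P v"
proof -
  have "(y, v) \<in> (adjacency E - {(x, y), (y, x)})\<^sup>*" using assms(1) by (simp add: half_tree_def)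
  then show ?thesis
  proof (induction rule: rtrancl_induct)
    case (step v w)
    then show ?case
      by (intro assms(3)[of v w]) (auto simp: half_tree_def adjacency_def doubleton_eq_iff)
  qed (rule root)
qed

lemma half_tree_subset:
  assumes "{x, y} \<in> E" shows "half_tree E x y \<subseteq> V"
proof
  fix v assume "v \<in> half_tree E x y"
  then show "v \<in> V" by (induction rule: half_tree_induct) (use assms edge in blast)+
qed

lemma half_tree_cover:
  assumes "{x, y} \<in> E" "v \<in> V"
  shows "v \<in> half_tree E x y \<or> v \<in> half_tree E y x"
proof -
  have "y \<in> V" using edge assms(1) by blast
  then obtain p where p: "p \<noteq> []" "hd p = y" "last p = v" "successively (\<lambda>x y. {x, y} \<in> E) p"
    using tree assms(2) unfolding is_tree_def path_between_def by metis
  have "v \<in> set p" using p(1,3) by auto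
  then have "(y, v) \<in> (adjacency E)\<^sup>*"
    using successively_imp_rtrancl[of "adjacency E" p v] p by (simp add: adjacency_def)
  then show ?thesis
  proof (induction rule: rtrancl_induct)
    case base
    show ?case using half_tree_refl by blast
  next
    case (step v w)
    then show ?case
      using half_tree_step[of v x y w] half_tree_step[of v y x w] half_tree_refl
      by (cases "{v, w} = {x, y}") (auto simp: adjacency_def doubleton_eq_iff insert_commute)
  qed
qed

text \<open>
  Acyclicity enters the argument here: a path back to \<open>x\<close> that does not use the edge would close up
  to a cycle with it.
\<close>
lemma bridge:
  assumes "{x, y} \<in> E" shows "x \<notin> half_tree E x y"
proof
  let ?r = "adjacency E - {(x, y), (y, x)}"
  assume x: "x \<in> half_tree E x y"
  then obtain p where p: "p \<noteq> []" "hd p = y" "last p = x" "distinct p"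
    "successively (\<lambda>x y. (x, y) \<in> ?r) p" "set p \<subseteq> ?r\<^sup>* `` {y}"
    using rtrancl_imp_distinct_path[of y x ?r] by (auto simp: half_tree_def)
  have "length p \<ge> 3"
  proof (rule ccontr)
    assume "\<not> length p \<ge> 3"
    with p(1) consider u where "p = [u]" | u v where "p = [u, v]"
      by (cases p; cases "tl p"; cases "tl (tl p)") auto
    then show False using p(2,3,5) edge[OF assms] by cases auto
  qed
  moreover have "set p \<subseteq> V"
    using p(6) half_tree_subset[OF assms] by (auto simp: half_tree_def)
  moreover have "successively (\<lambda>x y. {x, y} \<in> E) p"
    using p(5) by (rule successively_mono) (auto simp: adjacency_def)
  ultimately have "is_cycle V E p"
    using p assms by (auto simp: is_cycle_def)
  then show False using tree by (auto simp: is_tree_def)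
qed

lemma half_tree_disjoint:
  assumes "{x, y} \<in> E"
  shows "half_tree E x y \<inter> half_tree E y x = {}"
proof -
  let ?r = "adjacency E - {(x, y), (y, x)}"
  have False if v: "v \<in> half_tree E x y" "v \<in> half_tree E y x" for v
  proof -
    have "(y, v) \<in> ?r\<^sup>*" "(x, v) \<in> ?r\<^sup>*" using v by (auto simp: half_tree_def insert_commute)
    then have "(y, x) \<in> ?r\<^sup>*"
      using sym_rtrancl[OF sym_without_edge] by (meson rtrancl_trans symD)
    then show False using bridge[OF assms] by (simp add: half_tree_def)
  qed
  then show ?thesis by blast
qed

definition separated :: "'v \<Rightarrow> 'v \<Rightarrow> 'v \<Rightarrow> 'v \<Rightarrow> bool" where
  "separated a b c d \<longleftrightarrow>
     (\<exists>x y. {x, y} \<in> E \<and> {a, b} \<subseteq> half_tree E y x \<and> {c, d} \<subseteq> half_tree E x y)"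

lemma half_tree_connected:
  assumes "{x, y} \<in> E" "a \<in> half_tree E x y" "b \<in> half_tree E x y"
  obtains p where "path_between V E a p b" "set p \<subseteq> half_tree E x y"
proof -
  let ?r = "adjacency E - {(x, y), (y, x)}"
  have "(a, b) \<in> ?r\<^sup>*"
    using assms(2,3) sym_rtrancl[OF sym_without_edge] unfolding half_tree_def
    by (metis (no_types, lifting) mem_Collect_eq rtrancl_trans symD)
  then obtain p where p: "p \<noteq> []" "hd p = a" "last p = b" "distinct p"
    "successively (\<lambda>x y. (x, y) \<in> ?r) p" "set p \<subseteq> ?r\<^sup>* `` {a}"
    using rtrancl_imp_distinct_path by metis
  have sub: "set p \<subseteq> half_tree E x y"
    using p(6) assms(2) unfolding half_tree_def by (auto intro: rtrancl_trans)
  moreover have "successively (\<lambda>x y. {x, y} \<in> E) p"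
    using p(5) by (rule successively_mono) (auto simp: adjacency_def)
  ultimately have "path_between V E a p b"
    using p half_tree_subset[OF assms(1)] by (auto simp: path_between_def)
  then show ?thesis using sub that by blast
qed

lemma path_avoiding_end_in_half_tree:
  assumes p: "path_between V E a p b" and x: "x \<notin> set p" and a: "a \<in> half_tree E x y"
  shows "set p \<subseteq> half_tree E x y"
proof
  let ?r = "adjacency E - {(x, y), (y, x)}"
  fix v assume v: "v \<in> set p"
  have "successively (\<lambda>u v. {u, v} \<in> E) p" using p by (simp add: path_between_def)
  then have "successively (\<lambda>u v. (u, v) \<in> ?r) p"
    by (rule successively_mono) (use x in \<open>auto simp: adjacency_def\<close>)
  then have "(a, v) \<in> ?r\<^sup>*"
    using successively_imp_rtrancl[OF _ v] p by (auto simp: path_between_def)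
  then show "v \<in> half_tree E x y" using a by (auto simp: half_tree_def)
qed

text \<open>
  On the way from \<open>a\<close> to \<open>c\<close>, the edge by which the set of vertices of \<open>p\<close> is left for the last time
  separates \<open>p\<close> from \<open>q\<close>: after it \<open>p\<close> is avoided, and \<open>q\<close> avoids \<open>p\<close> anyway.
\<close>
lemma disjoint_paths_imp_separated:
  assumes p: "path_between V E a p b" and q: "path_between V E c q d" and disj: "set p \<inter> set q = {}"
  shows "separated a b c d"
proof -
  have ac: "a \<in> set p" "c \<in> set q" "a \<in> V" "c \<in> V"
    using p q by (auto simp: path_between_def)
  obtain w where w: "path_between V E a w c"
    using tree ac(3,4) unfolding is_tree_def by blast
  have "c \<in> set w" using w by (auto simp: path_between_def)
  then have "(a, c) \<in> (adjacency E)\<^sup>*"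
    using successively_imp_rtrancl[of "adjacency E" w c] w
    by (auto simp: path_between_def adjacency_def)
  \<comment> \<open>Induction from the end \<open>c\<close>: either \<open>p\<close> has not been met yet, or the last exit is already found.\<close>
  then have "(a \<notin> set p \<and> (a, c) \<in> (adjacency E \<inter> (- set p) \<times> (- set p))\<^sup>*) \<or>
    (\<exists>x y. {x, y} \<in> E \<and> x \<in> set p \<and> y \<notin> set p \<and>
       (y, c) \<in> (adjacency E \<inter> (- set p) \<times> (- set p))\<^sup>*)"
  proof (induction rule: converse_rtrancl_induct)
    case base
    then show ?case using disj ac by auto
  next
    case (step u v)
    show ?case
    proof (cases "v \<notin> set p \<and> (v, c) \<in> (adjacency E \<inter> (- set p) \<times> (- set p))\<^sup>*")
      case True
      show ?thesis
      proof (cases "u \<in> set p")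
        case True
        then show ?thesis using \<open>v \<notin> set p \<and> _\<close> step(1) by (auto simp: adjacency_def)
      next
        case False
        then have "(u, v) \<in> adjacency E \<inter> (- set p) \<times> (- set p)" using True step(1) by auto
        then show ?thesis using True False by (meson converse_rtrancl_into_rtrancl)
      qed
    qed (use step in blast)
  qed
  then obtain x y where xy: "{x, y} \<in> E" "x \<in> set p" "y \<notin> set p"
    and yc: "(y, c) \<in> (adjacency E \<inter> (- set p) \<times> (- set p))\<^sup>*" using ac by blast
  have "(adjacency E \<inter> (- set p) \<times> (- set p))\<^sup>* \<subseteq> (adjacency E - {(x, y), (y, x)})\<^sup>*"
    using xy by (intro rtrancl_mono) auto
  then have "c \<in> half_tree E x y" using yc by (auto simp: half_tree_def)
  moreover have "x \<notin> set q" using disj xy by blast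
  ultimately have "set q \<subseteq> half_tree E x y" using path_avoiding_end_in_half_tree[OF q] by blast
  moreover have "set p \<subseteq> half_tree E y x"
  proof (cases "a \<in> half_tree E y x")
    case True
    then show ?thesis using path_avoiding_end_in_half_tree[OF p xy(3)] by blast
  next
    case False
    let ?r = "adjacency E - {(x, y), (y, x)}"
    have "successively (\<lambda>u v. {u, v} \<in> E) p" using p by (simp add: path_between_def)
    then have "successively (\<lambda>u v. (u, v) \<in> ?r) p"
      by (rule successively_mono) (use xy in \<open>auto simp: adjacency_def\<close>)
    then have "(a, x) \<in> ?r\<^sup>*"
      using successively_imp_rtrancl[OF _ xy(2)] p by (auto simp: path_between_def)
    then have "(x, a) \<in> ?r\<^sup>*" using sym_rtrancl[OF sym_without_edge] by (meson symD)
    then show ?thesis using False by (simp add: half_tree_def insert_commute)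
  qed
  moreover have "b \<in> set p" "d \<in> set q" using p q by (auto simp: path_between_def)
  ultimately show ?thesis using xy(1) ac unfolding separated_def by blast
qed

lemma separated_iff_disjoint_paths:
  "separated a b c d \<longleftrightarrow>
    (\<exists>p q. path_between V E a p b \<and> path_between V E c q d \<and> set p \<inter> set q = {})"
proof
  assume "separated a b c d"
  then obtain x y where xy: "{x, y} \<in> E" "{a, b} \<subseteq> half_tree E y x" "{c, d} \<subseteq> half_tree E x y"
    by (auto simp: separated_def)
  then have yx: "{y, x} \<in> E" by (simp add: insert_commute)
  obtain p where "path_between V E a p b" "set p \<subseteq> half_tree E y x"
    using half_tree_connected[OF yx] xy(2) by blast
  moreover obtain q where "path_between V E c q d" "set q \<subseteq> half_tree E x y"
    using half_tree_connected[OF xy(1)] xy(3) by blast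
  ultimately show "\<exists>p q. path_between V E a p b \<and> path_between V E c q d \<and> set p \<inter> set q = {}"
    using half_tree_disjoint[OF xy(1)] by blast
qed (use disjoint_paths_imp_separated in blast)

lemma separated_sym:
  assumes "separated a b c d"
  shows "separated b a c d" "separated c d a b"
  using assms unfolding separated_def by (blast, metis insert_commute)

text \<open>
  The new vertex \<open>e\<close> lies on one of the two sides of the separating edge.
\<close>
lemma separated_extend:
  assumes "separated a b c d" "e \<in> V"
  shows "separated e a c d \<or> separated a b c e"
proof -
  obtain x y where xy: "{x, y} \<in> E" "{a, b} \<subseteq> half_tree E y x" "{c, d} \<subseteq> half_tree E x y"
    using assms(1) by (auto simp: separated_def)
  then show ?thesis
    using half_tree_cover[OF xy(1) assms(2)] unfolding separated_def by blast
qed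

text \<open>
  A half-tree that contains neither end of the edge between \<open>z\<close> and \<open>w\<close> stays connected when this edge
  is deleted.
\<close>
lemma half_tree_same_side:
  assumes xy: "{x, y} \<in> E" and zw: "{z, w} \<in> E" and z: "z \<notin> half_tree E x y" and "w \<notin> half_tree E x y"
    and u: "u \<in> half_tree E x y" and v: "v \<in> half_tree E x y" and uz: "u \<in> half_tree E z w"
  shows "v \<in> half_tree E z w"
proof -
  have *: "y \<in> half_tree E z w \<longleftrightarrow> t \<in> half_tree E z w" if "t \<in> half_tree E x y" for t
    using that
  proof (induction rule: half_tree_induct)
    case (step s t)
    have "{s, t} \<noteq> {z, w}" using step(1) assms by (auto simp: doubleton_eq_iff)
    then show ?case
      using step half_tree_step[of s z w t] half_tree_step[of t z w s] by (auto simp: insert_commute)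
  qed simp
  show ?thesis using *[OF u] *[OF v] uz by blast
qed

text \<open>
  Two edges cannot cross: unless they coincide, the second edge lies within one side of the first,
  so that the other side of the first is contained in a single side of the second. But each of the two
  sides contains two leaves that the other edge separates.
\<close>
lemma separated_exclusive:
  assumes "separated a b c d" shows "\<not> separated a c b d"
proof
  assume "separated a c b d"
  then obtain z w where zw: "{z, w} \<in> E" "{a, c} \<subseteq> half_tree E w z" "{b, d} \<subseteq> half_tree E z w"
    by (auto simp: separated_def)
  then have wz: "{w, z} \<in> E" by (simp add: insert_commute)
  obtain x y where xy: "{x, y} \<in> E" "{a, b} \<subseteq> half_tree E y x" "{c, d} \<subseteq> half_tree E x y"
    using assms by (auto simp: separated_def)
  then have yx: "{y, x} \<in> E" by (simp add: insert_commute)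
  note disj = half_tree_disjoint[OF xy(1)] half_tree_disjoint[OF zw(1)]
  have zwV: "z \<in> V" "w \<in> V" using edge zw by auto
  consider "z \<notin> half_tree E x y" "w \<notin> half_tree E x y"
    | "z \<notin> half_tree E y x" "w \<notin> half_tree E y x" | "{z, w} = {x, y}"
  proof -
    have "{z, w} = {x, y}" if "z \<in> half_tree E x y \<and> w \<in> half_tree E y x \<or>
        w \<in> half_tree E x y \<and> z \<in> half_tree E y x"
      using that half_tree_step[of z x y w] half_tree_step[of w x y z] zw wz disj(1)
      by (auto simp: insert_commute)
    then show ?thesis
      using that half_tree_cover[OF xy(1) zwV(1)] half_tree_cover[OF xy(1) zwV(2)] disj(1) by blast
  qed
  then show False
  proof cases
    case 1
    then have "c \<in> half_tree E z w"
      using half_tree_same_side[OF xy(1) zw(1), of d c] xy zw by blast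
    then show False using zw disj by blast
  next
    case 2
    then have "a \<in> half_tree E z w"
      using half_tree_same_side[OF yx zw(1), of b a] xy zw by blast
    then show False using zw disj by blast
  next
    case 3
    then show False using xy zw disj by (auto simp: doubleton_eq_iff)
  qed
qed

lemma vertex_degree_eq_card_neighbours: "vertex_degree E y = card {z. {y, z} \<in> E}"
proof -
  have "bij_betw (\<lambda>z. {y, z}) {z. {y, z} \<in> E} {e \<in> E. y \<in> e}"
  proof (rule bij_betw_imageI)
    show "inj_on (\<lambda>z. {y, z}) {z. {y, z} \<in> E}" by (auto simp: inj_on_def doubleton_eq_iff)
    have "e \<in> (\<lambda>z. {y, z}) ` {z. {y, z} \<in> E}" if e: "e \<in> E" "y \<in> e" for e
    proof -
      have "card e = 2" using e tree by (auto simp: is_tree_def simple_graph_def)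
      then obtain u v where "e = {u, v}" by (auto simp: card_2_iff)
      then have "\<exists>z. e = {y, z}" using e by auto
      then show ?thesis using e by auto
    qed
    then show "(\<lambda>z. {y, z}) ` {z. {y, z} \<in> E} = {e \<in> E. y \<in> e}" by auto
  qed
  from bij_betw_same_card[OF this] show ?thesis by (simp add: vertex_degree_def)
qed

lemma leaf_half_tree:
  assumes "{x, y} \<in> E" "y \<in> leaves V E"
  shows "half_tree E x y = {y}"
proof -
  have "card {z. {y, z} \<in> E} = 1"
    using assms(2) vertex_degree_eq_card_neighbours by (simp add: leaves_def)
  then have only: "z = x" if "{y, z} \<in> E" for z
  proof -
    have "z \<in> {z. {y, z} \<in> E}" "x \<in> {z. {y, z} \<in> E}"
      using that assms(1) by (simp_all add: insert_commute)
    then show ?thesis using \<open>card _ = 1\<close> by (metis card_1_singletonE singletonD)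
  qed
  have "v = y" if "v \<in> half_tree E x y" for v
    using that
  proof (induction rule: half_tree_induct)
    case (step v w)
    then show ?case using only[of w] by (auto simp: insert_commute)
  qed simp
  then show ?thesis using half_tree_refl by blast
qed

text \<open>
  Half-trees shrink when one moves away from \<open>x\<close>; this makes a minimal one useful.
\<close>
lemma half_tree_psubset:
  assumes "{x, y} \<in> E" "{y, z} \<in> E" "z \<noteq> x"
  shows "half_tree E y z \<subset> half_tree E x y"
proof -
  have "v \<in> half_tree E x y" if "v \<in> half_tree E y z" for v
    using that
  proof (induction rule: half_tree_induct)
    case root
    show ?case
      by (rule half_tree_step[OF half_tree_refl assms(2)]) (use assms edge in \<open>auto simp: doubleton_eq_iff\<close>)
  next
    case (step v w)
    have "w \<in> half_tree E y z" using step half_tree_step by blast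
    then have "{v, w} \<noteq> {x, y}" using step bridge[OF assms(2)] by (auto simp: doubleton_eq_iff)
    then show ?case using step half_tree_step by blast
  qed
  moreover have "y \<in> half_tree E x y" "y \<notin> half_tree E y z"
    using half_tree_refl bridge[OF assms(2)] by auto
  ultimately show ?thesis by blast
qed

end

locale finite_boron_tree = tree +
  assumes finite_vertices: "finite V" and boron: "boron_tree V E"
begin

text \<open>
  The degree being three, an inner vertex splits the half-tree behind it into two smaller ones.
\<close>
lemma inner_half_tree:
  assumes xy: "{x, y} \<in> E" and inner: "y \<notin> leaves V E"
  obtains z\<^sub>1 z\<^sub>2 where "{y, z\<^sub>1} \<in> E" "{y, z\<^sub>2} \<in> E" "z\<^sub>1 \<noteq> x" "z\<^sub>2 \<noteq> x"
    "half_tree E x y \<subseteq> insert y (half_tree E y z\<^sub>1 \<union> half_tree E y z\<^sub>2)"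
proof -
  have "y \<in> V" using xy edge by blast
  then have "card {z. {y, z} \<in> E} = 3"
    using boron inner vertex_degree_eq_card_neighbours by (auto simp: boron_tree_def leaves_def)
  then have "card ({z. {y, z} \<in> E} - {x}) = 2" using xy by (simp add: insert_commute)
  then obtain z\<^sub>1 z\<^sub>2 where z: "{z. {y, z} \<in> E} - {x} = {z\<^sub>1, z\<^sub>2}" by (auto simp: card_2_iff)
  have "v \<in> insert y (half_tree E y z\<^sub>1 \<union> half_tree E y z\<^sub>2)" if "v \<in> half_tree E x y" for v
    using that
  proof (induction rule: half_tree_induct)
    case (step v w)
    show ?case
    proof (cases "v = y")
      case True
      then have "w \<in> {z\<^sub>1, z\<^sub>2}" using step(2,3) z by (auto simp: insert_commute)
      then show ?thesis using half_tree_refl by blast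
    next
      case False
      then show ?thesis
        using step half_tree_step[of v y z\<^sub>1 w] half_tree_step[of v y z\<^sub>2 w]
        by (auto simp: doubleton_eq_iff)
    qed
  qed simp
  then show ?thesis using that[of z\<^sub>1 z\<^sub>2] z by blast
qed

text \<open>
  Among the half-trees that contain at least two of the four leaves choose a smallest one. Its root is
  an inner vertex, and the two half-trees behind the root contain at most one of the leaves each. So it
  contains exactly two of them, and its edge separates these from the other two.
\<close>
lemma ex_separated:
  assumes L: "{a, b, c, d} \<subseteq> leaves V E" and dist: "distinct [a, b, c, d]"
  shows "separated a b c d \<or> separated a c b d \<or> separated a d b c"
proof -
  let ?L = "{a, b, c, d}"
  define many where "many H \<longleftrightarrow> (\<exists>u\<in>?L. \<exists>v\<in>?L. u \<noteq> v \<and> u \<in> H \<and> v \<in> H)" for H :: "'a set"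
  define P where "P e \<longleftrightarrow> {fst e, snd e} \<in> E \<and> many (half_tree E (fst e) (snd e))" for e :: "'a \<times> 'a"
  \<comment> \<open>The half-tree opposite to the leaf \<open>a\<close> contains the three other leaves.\<close>
  have "card {z. {a, z} \<in> E} = 1"
    using L vertex_degree_eq_card_neighbours by (simp add: leaves_def)
  then obtain z where az: "{a, z} \<in> E" by (auto simp: card_1_singleton_iff)
  then have "half_tree E z a = {a}" using leaf_half_tree[of z a] L by (simp add: insert_commute)
  moreover have "b \<in> V" "c \<in> V" using L by (auto simp: leaves_def)
  ultimately have "b \<in> half_tree E a z" "c \<in> half_tree E a z"
    using half_tree_cover[OF az] dist by auto
  then have "P (a, z)" using az dist by (auto simp: P_def many_def)
  then obtain e where e: "P e" and
    min: "\<And>f. P f \<Longrightarrow> card (half_tree E (fst e) (snd e)) \<le> card (half_tree E (fst f) (snd f))"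
    using ex_has_least_nat[of P "(a, z)" "\<lambda>e. card (half_tree E (fst e) (snd e))"] by blast
  obtain x y where xy: "e = (x, y)" by (cases e)
  have E: "{x, y} \<in> E" and many: "many (half_tree E x y)" using e by (auto simp: P_def xy)
  have small: "\<not> many (half_tree E y z)" if "{y, z} \<in> E" "z \<noteq> x" for z
  proof
    assume "many (half_tree E y z)"
    then have "card (half_tree E x y) \<le> card (half_tree E y z)"
      using min[of "(y, z)"] that(1) by (simp add: P_def xy)
    moreover have "card (half_tree E y z) < card (half_tree E x y)"
      using psubset_card_mono half_tree_psubset[OF E that]
        finite_subset[OF half_tree_subset[OF E] finite_vertices] by blast
    ultimately show False by simp
  qed
  obtain u v where uv: "u \<in> ?L" "v \<in> ?L" "u \<noteq> v" "u \<in> half_tree E x y" "v \<in> half_tree E x y"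
    using many unfolding many_def by blast
  have inner: "y \<notin> leaves V E" using leaf_half_tree[OF E] uv(3-5) by auto
  then have y: "y \<notin> ?L" using L by blast
  obtain z\<^sub>1 z\<^sub>2 where z: "{y, z\<^sub>1} \<in> E" "{y, z\<^sub>2} \<in> E" "z\<^sub>1 \<noteq> x" "z\<^sub>2 \<noteq> x"
    "half_tree E x y \<subseteq> insert y (half_tree E y z\<^sub>1 \<union> half_tree E y z\<^sub>2)"
    by (rule inner_half_tree[OF E inner])
  \<comment> \<open>Of three leaves in this half-tree, two would lie in the same smaller one.\<close>
  have two: "t = u \<or> t = v" if "t \<in> ?L" "t \<in> half_tree E x y" for t
  proof (rule ccontr)
    assume t: "\<not> (t = u \<or> t = v)"
    have *: "s \<in> half_tree E y z\<^sub>1 \<or> s \<in> half_tree E y z\<^sub>2" if "s \<in> ?L" "s \<in> half_tree E x y" for s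
      using that z(5) y by blast
    have "many (half_tree E y z\<^sub>1) \<or> many (half_tree E y z\<^sub>2)"
      using *[OF that] *[OF uv(1,4)] *[OF uv(2,5)] t uv(1-3) that(1) unfolding many_def by blast
    then show False using small z by blast
  qed
  have other: "t \<in> half_tree E y x" if "t \<in> ?L" "t \<noteq> u" "t \<noteq> v" for t
    using half_tree_cover[OF E, of t] two[OF that(1)] that L by (auto simp: leaves_def)
  have sep: "separated p q r s \<and> separated r s p q"
    if pqrs: "{p, q, r, s} = ?L" "distinct [p, q, r, s]" and uv': "u \<in> {r, s}" "v \<in> {r, s}" for p q r s
  proof -
    have "{r, s} \<subseteq> half_tree E x y" using uv' uv(3-5) by auto
    moreover have "p \<in> half_tree E y x" "q \<in> half_tree E y x"
      using other[of p] other[of q] pqrs uv' by auto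
    ultimately have "separated p q r s" using E unfolding separated_def by blast
    then show ?thesis using separated_sym(2) by blast
  qed
  consider "u \<in> {a, b} \<and> v \<in> {a, b}" | "u \<in> {c, d} \<and> v \<in> {c, d}" | "u \<in> {a, c} \<and> v \<in> {a, c}"
    | "u \<in> {b, d} \<and> v \<in> {b, d}" | "u \<in> {a, d} \<and> v \<in> {a, d}" | "u \<in> {b, c} \<and> v \<in> {b, c}"
    using uv(1,2) by blast
  then show ?thesis
  proof cases
    case 1 then show ?thesis using sep[of c d a b] dist by (auto simp: insert_commute)
  next
    case 2 then show ?thesis using sep[of a b c d] dist by (auto simp: insert_commute)
  next
    case 3 then show ?thesis using sep[of b d a c] dist by (auto simp: insert_commute)
  next
    case 4 then show ?thesis using sep[of a c b d] dist by (auto simp: insert_commute)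
  next
    case 5 then show ?thesis using sep[of b c a d] dist by (auto simp: insert_commute)
  next
    case 6 then show ?thesis using sep[of a d b c] dist by (auto simp: insert_commute)
  qed
qed

end

text \<open>
  The laws of the relation \<open>ab|cd\<close> on the leaves of a boron tree that the counting argument needs.
  Each of them concerns finitely many points, so that a structure satisfies them as soon as its finite
  substructures do.
\<close>
locale quartet_structure =
  fixes K :: "'a rel_structure"
  assumes arity: "xs \<in> rel K \<Longrightarrow> length xs = 4"
    and distinct: "[a, b, c, d] \<in> rel K \<Longrightarrow> distinct [a, b, c, d] \<and> {a, b, c, d} \<subseteq> universe K"
    and sym: "[a, b, c, d] \<in> rel K \<Longrightarrow> [b, a, c, d] \<in> rel K \<and> [c, d, a, b] \<in> rel K"
    and exclusive: "[a, b, c, d] \<in> rel K \<Longrightarrow> [a, c, b, d] \<notin> rel K"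
    and extend: "[a, b, c, d] \<in> rel K \<Longrightarrow> e \<in> universe K \<Longrightarrow> e \<notin> {a, b, c, d} \<Longrightarrow>
       [e, a, c, d] \<in> rel K \<or> [a, b, c, e] \<in> rel K"
    and total: "{a, b, c, d} \<subseteq> universe K \<Longrightarrow> distinct [a, b, c, d] \<Longrightarrow>
       [a, b, c, d] \<in> rel K \<or> [a, c, b, d] \<in> rel K \<or> [a, d, b, c] \<in> rel K"

lemma quartet_structure_leaf_structure:
  assumes "finite V" "boron_tree V E"
  shows "quartet_structure (leaf_structure V E)"
proof -
  interpret finite_boron_tree V E
    by unfold_locales (use assms in \<open>auto simp: boron_tree_def\<close>)
  have rel: "[a, b, c, d] \<in> rel (leaf_structure V E) \<longleftrightarrow>
      {a, b, c, d} \<subseteq> leaves V E \<and> distinct [a, b, c, d] \<and> separated a b c d" for a b c d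
    unfolding leaf_structure_def separated_iff_disjoint_paths by auto
  have univ: "universe (leaf_structure V E) = leaves V E" by (simp add: leaf_structure_def)
  show ?thesis
  proof (unfold_locales, goal_cases)
    case (1 xs) then show ?case by (auto simp: leaf_structure_def)
  next
    case (2 a b c d) then show ?case unfolding rel univ by blast
  next
    case (3 a b c d) then show ?case unfolding rel using separated_sym[of a b c d] by auto
  next
    case (4 a b c d) then show ?case unfolding rel using separated_exclusive by blast
  next
    case (5 a b c d e)
    moreover have "e \<in> V" using 5 by (auto simp: univ leaves_def)
    ultimately show ?case unfolding rel univ using separated_extend[of a b c d e] by auto
  next
    case (6 a b c d) then show ?case unfolding rel univ using ex_separated[of a b c d] by auto
  qed
qed

lemma quartet_structure_iso:
  assumes f: "is_isomorphism f K L" and wf: "well_formed K" and "quartet_structure L"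
  shows "quartet_structure K"
proof -
  interpret L: quartet_structure L by fact
  have U: "{a, b, c, d} \<subseteq> universe K" if "[a, b, c, d] \<in> rel K" for a b c d
    using that wf by (auto simp: well_formed_def)
  have rel: "[a, b, c, d] \<in> rel K \<longleftrightarrow> [f a, f b, f c, f d] \<in> rel L"
    if "{a, b, c, d} \<subseteq> universe K" for a b c d
    using f that unfolding is_isomorphism_def by (auto dest: bspec[of _ _ "[a, b, c, d]"])
  have inj: "f a = f b \<longleftrightarrow> a = b" if "a \<in> universe K" "b \<in> universe K" for a b
    using f that by (auto simp: is_isomorphism_def bij_betw_def inj_on_eq_iff)
  have img: "f a \<in> universe L" if "a \<in> universe K" for a
    using f that by (auto simp: is_isomorphism_def bij_betw_def)
  show ?thesis
  proof (unfold_locales, goal_cases)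
    case (1 xs)
    then have "xs \<in> lists (universe K)" using wf by (auto simp: well_formed_def)
    then have "map f xs \<in> rel L" using f 1 by (simp add: is_isomorphism_def)
    then show ?case using L.arity by fastforce
  next
    case (2 a b c d)
    then show ?case using U[OF 2] rel[OF U[OF 2]] L.distinct[of "f a" "f b" "f c" "f d"] by auto
  next
    case (3 a b c d)
    then show ?case using U[OF 3] rel[OF U[OF 3]] rel[of b a c d] rel[of c d a b]
        L.sym[of "f a" "f b" "f c" "f d"] by auto
  next
    case (4 a b c d)
    then show ?case using U[OF 4] rel[OF U[OF 4]] rel[of a c b d]
        L.exclusive[of "f a" "f b" "f c" "f d"] by auto
  next
    case (5 a b c d e)
    then show ?case using U[OF 5(1)] rel[OF U[OF 5(1)]] rel[of e a c d] rel[of a b c e]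
        L.extend[of "f a" "f b" "f c" "f d" "f e"] img inj by auto
  next
    case (6 a b c d)
    then show ?case using rel[of a b c d] rel[of a c b d] rel[of a d b c]
        L.total[of "f a" "f b" "f c" "f d"] img inj by auto
  qed
qed

lemma isomorphic_sym:
  assumes "isomorphic K L" shows "isomorphic L K"
proof -
  obtain f where f: "is_isomorphism f K L" using assms by (auto simp: isomorphic_def)
  let ?g = "inv_into (universe K) f"
  have bij: "bij_betw f (universe K) (universe L)" using f by (simp add: is_isomorphism_def)
  have g: "bij_betw ?g (universe L) (universe K)" by (rule bij_betw_inv_into[OF bij])
  have "xs \<in> rel L \<longleftrightarrow> map ?g xs \<in> rel K" if xs: "xs \<in> lists (universe L)" for xs
  proof -
    have "map ?g xs \<in> lists (universe K)" using xs g unfolding bij_betw_def lists_eq_set by auto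
    moreover have "map f (map ?g xs) = xs"
      using xs bij by (auto simp: bij_betw_inv_into_right intro!: map_idI)
    ultimately show ?thesis using f unfolding is_isomorphism_def by metis
  qed
  then show ?thesis using g unfolding isomorphic_def is_isomorphism_def by blast
qed

lemma quartet_structure_boron_class:
  assumes "C \<in> boron_class" shows "quartet_structure C"
proof -
  have wf: "well_formed C" using assms by (simp add: boron_class_def)
  consider (tree) V :: "nat set" and E where "finite V" "boron_tree V E" "isomorphic (leaf_structure V E) C"
    | (point) x where "C = \<lparr>universe = {x}, rel = {}\<rparr>"
    using assms unfolding boron_class_def by blast
  then show ?thesis
  proof cases
    case tree
    then obtain f where "is_isomorphism f C (leaf_structure V E)"
      using isomorphic_sym unfolding isomorphic_def by blast
    then show ?thesis using quartet_structure_iso wf quartet_structure_leaf_structure tree by blast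
  next
    case point
    show ?thesis by unfold_locales (auto simp: point)
  qed
qed

text \<open>
  The points that a law speaks about form a finite substructure, which up to isomorphism is a
  member of the age and hence comes from a boron tree.
\<close>
lemma quartet_structure_Fraisse_limit:
  assumes T: "is_Fraisse_limit T boron_class" shows "quartet_structure T"
proof -
  have wf: "well_formed T" and age: "age T = boron_class" using T by (auto simp: is_Fraisse_limit_def)
  have sub: "quartet_structure (substructure T A)" if A: "finite A" "A \<subseteq> universe T" "A \<noteq> {}" for A
  proof -
    have wfA: "well_formed (substructure T A)" by (auto simp: well_formed_def substructure_def)
    \<comment> \<open>The age consists of structures on natural numbers, so the substructure is first copied there.\<close>
    obtain h :: "'a \<Rightarrow> nat" where h: "inj_on h A" using finite_imp_inj_to_nat_seg[OF A(1)] by blast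
    let ?C = "\<lparr>universe = h ` A, rel = map h ` rel (substructure T A)\<rparr>"
    have "is_isomorphism h (substructure T A) ?C"
    proof -
      have "xs \<in> rel (substructure T A)"
        if xs: "xs \<in> lists A" and hxs: "map h xs \<in> map h ` rel (substructure T A)" for xs
      proof -
        obtain ys where ys: "ys \<in> rel (substructure T A)" "map h xs = map h ys"
          using hxs by (elim imageE)
        then have "ys \<in> lists A" by (auto simp: substructure_def)
        then have "xs = ys" using ys(2) xs h
          by (metis in_lists_conv_set inj_on_map_eq_map[of h xs ys] inj_on_subset le_sup_iff subsetI)
        then show ?thesis using ys by simp
      qed
      then show ?thesis
        using h by (auto simp: is_isomorphism_def bij_betw_def substructure_def simp del: in_lists_conv_set)
    qed
    moreover have "well_formed ?C" by (auto simp: well_formed_def substructure_def)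
    ultimately have "?C \<in> age T" using A unfolding age_def isomorphic_def by blast
    then have "quartet_structure ?C" using quartet_structure_boron_class age by blast
    then show ?thesis using quartet_structure_iso \<open>is_isomorphism h _ ?C\<close> wfA by blast
  qed
  have U: "{a, b, c, d} \<subseteq> universe T" if "[a, b, c, d] \<in> rel T" for a b c d
    using that wf by (auto simp: well_formed_def)
  show ?thesis
  proof (unfold_locales, goal_cases)
    case (1 xs)
    \<comment> \<open>The extra point is there for the empty list, as the empty structure is not in the age.\<close>
    obtain u where u: "u \<in> universe T" using T by (metis finite.emptyI is_Fraisse_limit_def equals0I)
    have "insert u (set xs) \<subseteq> universe T" using u 1 wf by (auto simp: well_formed_def)
    then interpret S: quartet_structure "substructure T (insert u (set xs))" by (intro sub) auto
    show ?case using 1 S.arity[of xs] by (auto simp: substructure_def)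
  next
    case (2 a b c d)
    interpret S: quartet_structure "substructure T {a, b, c, d}" by (rule sub) (use U[OF 2] in auto)
    show ?case using 2 U[OF 2] S.distinct[of a b c d] by (auto simp: substructure_def)
  next
    case (3 a b c d)
    interpret S: quartet_structure "substructure T {a, b, c, d}" by (rule sub) (use U[OF 3] in auto)
    show ?case using 3 S.sym[of a b c d] by (auto simp: substructure_def)
  next
    case (4 a b c d)
    interpret S: quartet_structure "substructure T {a, b, c, d}" by (rule sub) (use U[OF 4] in auto)
    show ?case using 4 S.exclusive[of a b c d] by (auto simp: substructure_def)
  next
    case (5 a b c d e)
    interpret S: quartet_structure "substructure T {a, b, c, d, e}" by (rule sub) (use U[OF 5(1)] 5(2) in auto)
    show ?case using 5 S.extend[of a b c d e] by (auto simp: substructure_def)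
  next
    case (6 a b c d)
    interpret S: quartet_structure "substructure T {a, b, c, d}" by (rule sub) (use 6 in auto)
    show ?case using 6 S.total[of a b c d] by (auto simp: substructure_def)
  qed
qed

section \<open>The Fraisse limit of the boron trees\<close>

context quartet_structure begin

lemma swap: "[a, b, c, d] \<in> rel K \<Longrightarrow> [b, a, c, d] \<in> rel K"
  "[a, b, c, d] \<in> rel K \<Longrightarrow> [a, b, d, c] \<in> rel K"
  "[a, b, c, d] \<in> rel K \<Longrightarrow> [c, d, a, b] \<in> rel K"
  using sym by blast+

lemma no_rel_of_size_three:
  assumes "card A \<le> 3" "finite A" shows "rel (substructure K A) = {}"
proof -
  have False if xs: "xs \<in> rel K" "set xs \<subseteq> A" for xs
  proof -
    obtain a b c d where abcd: "xs = [a, b, c, d]"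
      using arity[OF xs(1)] by (auto simp: numeral_eq_Suc length_Suc_conv)
    then have "card (set xs) = 4" using distinct[of a b c d] xs(1) by simp
    then show False using card_mono[OF assms(2) xs(2)] assms(1) by simp
  qed
  then show ?thesis by (auto simp: substructure_def lists_eq_set)
qed

text \<open>
  The triples \<open>(a, b, c)\<close> for which \<open>e\<close> hangs on the branch of \<open>a\<close> in the tripod spanned by \<open>a, b, c\<close>. The
  leaf \<open>e\<close> itself counts as hanging on its own branch, so that triples containing \<open>e\<close> need no separate
  treatment later.
\<close>
definition pendant :: "'a \<Rightarrow> 'a list set" where
  "pendant e = {[a, b, c] | a b c. e = a \<or> [e, a, b, c] \<in> rel K}"

lemma pendant_iff: "[a, b, c] \<in> pendant e \<longleftrightarrow> e = a \<or> [e, a, b, c] \<in> rel K"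
  by (simp add: pendant_def)

lemma pendant_cover:
  assumes "{a, b, c} \<subseteq> universe K" "distinct [a, b, c]" "e \<in> universe K"
  shows "[a, b, c] \<in> pendant e \<or> [b, a, c] \<in> pendant e \<or> [c, a, b] \<in> pendant e"
  using assms total[of e a b c] unfolding pendant_iff by auto

lemma pendant_exclusive_cherry:
  assumes "distinct [a, b, c]" "[a, b, c] \<in> pendant e"
  shows "[b, a, c] \<notin> pendant e"
  using assms distinct[of e a b c] distinct[of e b a c] exclusive[of e a b c] unfolding pendant_iff by auto

text \<open>
  If \<open>e\<close> hung on a pendant branch at the side of \<open>a, b\<close> and also on one at the side of \<open>c, d\<close>, it would
  lie on both sides of the edge that separates \<open>ab|cd\<close>. The pairs \<open>x, x'\<close> and \<open>y, y'\<close> allow for either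
  order of \<open>a, b\<close> and of \<open>c, d\<close>.
\<close>
lemma pendant_exclusive_opposite:
  assumes abcd: "[a, b, c, d] \<in> rel K" and e: "e \<in> universe K"
    and ab: "{x, x'} = {a, b}" and cd: "{y, y'} = {c, d}" and x: "[x, x', c] \<in> pendant e"
  shows "[y, y', a] \<notin> pendant e"
proof
  assume y: "[y, y', a] \<in> pendant e"
  have dist: "distinct [a, b, c, d]" using distinct[OF abcd] by blast
  have xx: "x = a \<and> x' = b \<or> x = b \<and> x' = a" and yy: "y = c \<and> y' = d \<or> y = d \<and> y' = c"
    using ab cd by (auto simp: doubleton_eq_iff)
  have R: "[x, x', y, y'] \<in> rel K" using abcd xx yy swap by blast
  have xy: "x \<noteq> y" using xx yy dist by auto
  have ne: "e \<noteq> x"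
  proof
    assume "e = x"
    then have xyy: "[x, y, y', a] \<in> rel K" using y xy by (simp add: pendant_iff)
    then have "x' = a" using distinct[OF xyy] xx by auto
    then show False using exclusive[OF R] swap(2)[OF xyy] by blast
  qed
  have ne': "e \<noteq> y"
  proof
    assume "e = y"
    then have yxx: "[y, x, x', c] \<in> rel K" using x xy by (simp add: pendant_iff)
    then have "y' = c" using distinct[OF yxx] yy by auto
    then show False using exclusive[OF swap(3)[OF R]] swap(2)[OF yxx] by blast
  qed
  have ex: "[e, x, x', c] \<in> rel K" and ey: "[e, y, y', a] \<in> rel K"
    using x y ne ne' by (auto simp: pendant_iff)
  then have "e \<notin> {a, b, c, d}" using xx yy distinct[OF ex] distinct[OF ey] by auto
  then consider "[e, a, c, d] \<in> rel K" | "[a, b, c, e] \<in> rel K" using extend[OF abcd e] by blast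
  then show False
  proof cases
    case 1
    then have "[e, a, y, y'] \<in> rel K" using yy swap(2) by blast
    from exclusive[OF this] show False using swap(2)[OF ey] by blast
  next
    case 2
    then have "[e, c, x, x'] \<in> rel K" using xx swap by blast
    from exclusive[OF this] show False using swap(2)[OF ex] by blast
  qed
qed

end

text \<open>
  The relation holds only of four distinct points and is therefore empty on three-element subsets, so
  that every bijection between two of them extends by ultrahomogeneity.
\<close>
lemma Fraisse_limit_Aut_transitive_on_triples:
  assumes T: "is_Fraisse_limit T boron_class"
    and a: "distinct [a, b, c]" "{a, b, c} \<subseteq> universe T"
    and a': "distinct [a', b', c']" "{a', b', c'} \<subseteq> universe T"
  obtains g where "g \<in> carrier (Aut T)" "map g [a, b, c] = [a', b', c']"
proof -
  interpret quartet_structure T using quartet_structure_Fraisse_limit[OF T] .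
  define f where "f = (\<lambda>x. if x = a then a' else if x = b then b' else c')"
  have "rel (substructure T {a, b, c}) = {}" "rel (substructure T {a', b', c'}) = {}"
    by (intro no_rel_of_size_three; simp add: card_insert_if)+
  moreover have "bij_betw f {a, b, c} {a', b', c'}"
    using a(1) a'(1) by (auto simp: bij_betw_def inj_on_def f_def)
  ultimately have "is_isomorphism f (substructure T {a, b, c}) (substructure T {a', b', c'})"
    unfolding is_isomorphism_def by (simp add: substructure_def)
  moreover have "ultrahomogeneous T" using T by (simp add: is_Fraisse_limit_def)
  ultimately have "\<exists>g\<in>carrier (Aut T). \<forall>x\<in>{a, b, c}. g x = f x"
    using a(2) a'(2) unfolding ultrahomogeneous_def by blast
  then show ?thesis using that a(1) by (auto simp: f_def)
qed

text \<open>
  For the random relation \<open>S\<close> obtained from \<open>pendant a\<close>, all the events \<open>S [x, y, z]\<close> with distinct leaves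
  have the same probability. Three of them cover the space, whereas the four that belong to the pendant
  branches of a quartet \<open>ab|cd\<close> are disjoint.
\<close>
theorem Aut_boron_Fraisse_limit_not_amenable:
  assumes T: "is_Fraisse_limit T boron_class"
  shows "\<not> amenable (Aut T) (Aut_topology T)"
proof
  assume amen: "amenable (Aut T) (Aut_topology T)"
  let ?U = "universe T"
  interpret quartet_structure T using quartet_structure_Fraisse_limit[OF T] .
  have inf: "infinite ?U" using T by (simp add: is_Fraisse_limit_def)
  then obtain A where A: "finite A" "card A = 4" "A \<subseteq> ?U" using infinite_arbitrarily_large by blast
  obtain xs where xs: "set xs = A" "distinct xs" using finite_distinct_list[OF A(1)] by blast
  then have "length xs = 4" using A(2) distinct_card by metis
  then obtain p q r s where "xs = [p, q, r, s]" by (auto simp: numeral_eq_Suc length_Suc_conv)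
  then have "{p, q, r, s} \<subseteq> ?U" "distinct [p, q, r, s]" using xs A by auto
  then obtain a b c d where abcd: "[a, b, c, d] \<in> rel T"
    using total[of p q r s] by blast
  then have U: "{a, b, c, d} \<subseteq> ?U" and dist: "distinct [a, b, c, d]" using distinct by blast+
  obtain M :: "('a list \<Rightarrow> bool) measure" where "prob_space M"
    and meas: "\<And>xs. xs \<in> lists ?U \<Longrightarrow> {S \<in> space M. S xs} \<in> sets M"
    and inv: "\<And>g A. g \<in> carrier (Aut T) \<Longrightarrow> A \<in> sets M \<Longrightarrow>
       measure M {S \<in> space M. pull_back T g S \<in> A} = measure M A"
    and pull: "\<And>g S. g \<in> carrier (Aut T) \<Longrightarrow> S \<in> space M \<Longrightarrow> pull_back T g S \<in> space M"
    and approx: "\<And>S F. S \<in> space M \<Longrightarrow> finite F \<Longrightarrow> F \<subseteq> lists ?U \<Longrightarrow>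
       \<exists>g\<in>carrier (Aut T). \<forall>xs\<in>F. S xs \<longleftrightarrow> map g xs \<in> pendant a"
    using amenable_imp_invariant_random_relation[OF amen, of "pendant a"] by blast
  interpret M: prob_space M by fact
  define Ev where "Ev x y z = {S \<in> space M. S [x, y, z]}" for x y z
  have Ev: "Ev x y z \<in> sets M" if "{x, y, z} \<subseteq> ?U" for x y z
    using that meas[of "[x, y, z]"] by (simp add: Ev_def)
  have eq: "measure M (Ev x y z) = measure M (Ev a b c)"
    if xyz: "{x, y, z} \<subseteq> ?U" "distinct [x, y, z]" for x y z
  proof -
    have abc: "distinct [a, b, c]" "{a, b, c} \<subseteq> ?U" using dist U by auto
    obtain g where g: "g \<in> carrier (Aut T)" "map g [a, b, c] = [x, y, z]"
      using Fraisse_limit_Aut_transitive_on_triples[OF T abc xyz(2,1)] .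
    have "{S \<in> space M. pull_back T g S \<in> Ev a b c} = Ev x y z"
      using pull[OF g(1)] g(2) abc(2) by (auto simp: Ev_def pull_back_def)
    then show ?thesis using inv[OF g(1) Ev[OF abc(2)]] by simp
  qed
  have cover: "space M \<subseteq> Ev a b c \<union> Ev b a c \<union> Ev c a b"
  proof
    fix S assume S: "S \<in> space M"
    have "finite {[a, b, c], [b, a, c], [c, a, b]}" "{[a, b, c], [b, a, c], [c, a, b]} \<subseteq> lists ?U"
      using U by auto
    from approx[OF S this] obtain g where g: "g \<in> carrier (Aut T)"
      "\<forall>xs\<in>{[a, b, c], [b, a, c], [c, a, b]}. S xs \<longleftrightarrow> map g xs \<in> pendant a"
      by (rule bexE)
    have "{g a, g b, g c} \<subseteq> ?U" using carrier_Aut_maps[OF g(1)] U by auto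
    moreover have "distinct [g a, g b, g c]"
    proof -
      have "inj_on g ?U" using g(1) by (auto simp: carrier_Aut Bij_def bij_betw_def)
      then show ?thesis using dist U by (auto simp: inj_on_eq_iff)
    qed
    ultimately show "S \<in> Ev a b c \<union> Ev b a c \<union> Ev c a b"
      using pendant_cover[of "g a" "g b" "g c" a] g(2) S U by (auto simp: Ev_def)
  qed
  have excl: "S [a, b, c] \<longrightarrow> \<not> S [b, a, c]" "S [c, d, a] \<longrightarrow> \<not> S [d, c, a]"
    "S [a, b, c] \<or> S [b, a, c] \<longrightarrow> \<not> S [c, d, a] \<and> \<not> S [d, c, a]" if S: "S \<in> space M" for S
  proof -
    have "finite {[a, b, c], [b, a, c], [c, d, a], [d, c, a]}"
      "{[a, b, c], [b, a, c], [c, d, a], [d, c, a]} \<subseteq> lists ?U" using U by auto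
    from approx[OF S this] obtain g where g: "g \<in> carrier (Aut T)"
      "\<forall>xs\<in>{[a, b, c], [b, a, c], [c, d, a], [d, c, a]}. S xs \<longleftrightarrow> map g xs \<in> pendant a"
      by (rule bexE)
    have R: "[g a, g b, g c, g d] \<in> rel T"
      using map_Aut_rel[OF g(1), of "[a, b, c, d]"] U abcd by auto
    have dist': "distinct [g a, g b, g c]" "distinct [g c, g d, g a]" using distinct[OF R] by auto
    have a: "a \<in> ?U" using U by simp
    show "S [a, b, c] \<longrightarrow> \<not> S [b, a, c]" "S [c, d, a] \<longrightarrow> \<not> S [d, c, a]"
      using g(2) pendant_exclusive_cherry[OF dist'(1)] pendant_exclusive_cherry[OF dist'(2)] by auto
    show "S [a, b, c] \<or> S [b, a, c] \<longrightarrow> \<not> S [c, d, a] \<and> \<not> S [d, c, a]"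
      using g(2) pendant_exclusive_opposite[OF R a, of "g a" "g b" "g c" "g d"]
        pendant_exclusive_opposite[OF R a, of "g b" "g a" "g c" "g d"]
        pendant_exclusive_opposite[OF R a, of "g a" "g b" "g d" "g c"]
        pendant_exclusive_opposite[OF R a, of "g b" "g a" "g d" "g c"] by (auto simp: insert_commute)
  qed
  let ?m = "measure M (Ev a b c)"
  have m: "measure M (Ev b a c) = ?m" "measure M (Ev c a b) = ?m"
     "measure M (Ev c d a) = ?m" "measure M (Ev d c a) = ?m"
    using U dist by (auto intro!: eq)
  have sets: "Ev a b c \<in> sets M" "Ev b a c \<in> sets M" "Ev c a b \<in> sets M"
    "Ev c d a \<in> sets M" "Ev d c a \<in> sets M" using U by (auto intro!: Ev)
  have "1 = measure M (space M)" by (simp add: M.prob_space)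
  also have "\<dots> \<le> measure M (Ev a b c \<union> Ev b a c \<union> Ev c a b)"
    using cover sets by (intro M.finite_measure_mono) auto
  also have "\<dots> \<le> measure M (Ev a b c \<union> Ev b a c) + measure M (Ev c a b)"
    using sets by (intro measure_Un_le) auto
  also have "\<dots> \<le> measure M (Ev a b c) + measure M (Ev b a c) + measure M (Ev c a b)"
    using sets by (intro add_right_mono measure_Un_le) auto
  finally have "1 \<le> 3 * ?m" using m by simp
  moreover have "4 * ?m \<le> 1"
  proof -
    have "4 * ?m = measure M (Ev a b c) + measure M (Ev b a c) + (measure M (Ev c d a) + measure M (Ev d c a))"
      using m by simp
    also have "measure M (Ev a b c) + measure M (Ev b a c) = measure M (Ev a b c \<union> Ev b a c)"
      using sets excl by (intro M.finite_measure_Union[symmetric]) (auto simp: Ev_def)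
    also have "measure M (Ev c d a) + measure M (Ev d c a) = measure M (Ev c d a \<union> Ev d c a)"
      using sets excl by (intro M.finite_measure_Union[symmetric]) (auto simp: Ev_def)
    also have "measure M (Ev a b c \<union> Ev b a c) + measure M (Ev c d a \<union> Ev d c a) =
        measure M ((Ev a b c \<union> Ev b a c) \<union> (Ev c d a \<union> Ev d c a))"
      using sets excl by (intro M.finite_measure_Union[symmetric]) (auto simp: Ev_def)
    also have "\<dots> \<le> 1" by simp
    finally show ?thesis .
  qed
  ultimately show False by simp
qed

section \<open>Order automorphisms by back and forth\<close>

text \<open>
  Enumerating \<open>D\<close> and adding each point in turn to the domain and to the range gives an increasing
  sequence of sets satisfying \<open>P\<close>; the relation \<open>R\<close> is its union. Any two of its pairs already occur at
  a finite stage, which is how laws about two pairs pass to \<open>R\<close>.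
\<close>
lemma back_and_forth:
  fixes P :: "('a \<times> 'a) set \<Rightarrow> bool"
  assumes D: "countable D" and p\<^sub>0: "P p\<^sub>0"
    and ext_dom: "\<And>p a. P p \<Longrightarrow> a \<in> D \<Longrightarrow> \<exists>b. P (insert (a, b) p)"
    and ext_ran: "\<And>p b. P p \<Longrightarrow> b \<in> D \<Longrightarrow> \<exists>a. P (insert (a, b) p)"
  shows "\<exists>R. p\<^sub>0 \<subseteq> R \<and> D \<subseteq> Domain R \<and> D \<subseteq> Range R \<and>
    (\<forall>u\<in>R. \<forall>v\<in>R. \<exists>p. P p \<and> u \<in> p \<and> v \<in> p)"
proof (cases "D = {}")
  case True
  then show ?thesis using p\<^sub>0 by blast
next
  case False
  have ext: "\<exists>p'. P p' \<and> p \<subseteq> p' \<and> d \<in> Domain p' \<and> d \<in> Range p'" if "P p" "d \<in> D" for p d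
  proof -
    obtain b where b: "P (insert (d, b) p)" using ext_dom \<open>P p\<close> \<open>d \<in> D\<close> by blast
    then obtain a where "P (insert (a, d) (insert (d, b) p))" using ext_ran \<open>d \<in> D\<close> by blast
    then show ?thesis by blast
  qed
  define e where "e = from_nat_into D"
  have e: "e n \<in> D" for n using from_nat_into[OF False] by (simp add: e_def)
  have "\<exists>s. \<forall>n. (P (s n) \<and> (n = 0 \<longrightarrow> s n = p\<^sub>0)) \<and>
      (s n \<subseteq> s (Suc n) \<and> e n \<in> Domain (s (Suc n)) \<and> e n \<in> Range (s (Suc n)))"
    by (rule dependent_nat_choice) (use p\<^sub>0 ext e in auto)
  then obtain s where s: "\<And>n. P (s n)" "s 0 = p\<^sub>0" "\<And>n. s n \<subseteq> s (Suc n)"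
    "\<And>n. e n \<in> Domain (s (Suc n))" "\<And>n. e n \<in> Range (s (Suc n))" by metis
  have mono: "s m \<subseteq> s n" if "m \<le> n" for m n by (rule lift_Suc_mono_le[of s, OF s(3) that])
  have dom_ran: "d \<in> Domain (\<Union>n. s n) \<and> d \<in> Range (\<Union>n. s n)" if d: "d \<in> D" for d
  proof -
    obtain n where "d = e n" using from_nat_into_surj[OF D d] by (auto simp: e_def)
    then show ?thesis using s(4)[of n] s(5)[of n] by blast
  qed
  have pair: "\<exists>p. P p \<and> u \<in> p \<and> v \<in> p" if uv: "u \<in> (\<Union>n. s n)" "v \<in> (\<Union>n. s n)" for u v
  proof -
    obtain m n where "u \<in> s m" "v \<in> s n" using uv by blast
    then show ?thesis using mono[of m "max m n"] mono[of n "max m n"] s(1)[of "max m n"] by auto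
  qed
  show ?thesis
  proof (rule exI[of _ "\<Union>n. s n"], intro conjI ballI)
    show "\<exists>p. P p \<and> u \<in> p \<and> v \<in> p" if "u \<in> (\<Union>n. s n)" "v \<in> (\<Union>n. s n)" for u v
      using that by (rule pair)
    show "p\<^sub>0 \<subseteq> (\<Union>n. s n)" using s(2) by blast
    show "D \<subseteq> Domain (\<Union>n. s n)" "D \<subseteq> Range (\<Union>n. s n)" using dom_ran by (intro subsetI; simp)+
  qed
qed

text \<open>
  A countable part \<open>D\<close> of an interval that is a union of cosets of the rationals, cut off at the ends.
  Each coset is dense, so a point can be moved within its coset into any gap.
\<close>
locale coset_interval =
  fixes D :: "real set" and \<alpha> :: real
  assumes sub: "D \<subseteq> {0..<\<alpha>}" and count: "countable D"
    and closed: "t \<in> D \<Longrightarrow> h \<in> \<rat> \<Longrightarrow> t + h \<in> {0..<\<alpha>} \<Longrightarrow> t + h \<in> D"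
begin

text \<open>
  The pair \<open>(0, 0)\<close> keeps the left end in place, which provides a lower bound for every other image.
\<close>
definition partial_iso :: "(real \<times> real) set \<Rightarrow> bool" where
  "partial_iso p \<longleftrightarrow> finite p \<and> p \<subseteq> D \<times> D \<and> (0, 0) \<in> p \<and>
     (\<forall>(a, b)\<in>p. b - a \<in> \<rat>) \<and> (\<forall>(a, b)\<in>p. \<forall>(c, d)\<in>p. a < c \<longleftrightarrow> b < d)"

lemma partial_iso_converse:
  assumes "partial_iso p" shows "partial_iso (p\<inverse>)"
proof -
  have "a - b \<in> \<rat>" if "(a, b) \<in> p" for a b
    using assms that Rats_minus_iff[of "b - a"] by (auto simp: partial_iso_def)
  then show ?thesis using assms unfolding partial_iso_def by auto
qed

lemma partial_iso_forth:
  assumes p: "partial_iso p" and a: "a \<in> D"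
  shows "\<exists>b. partial_iso (insert (a, b) p)"
proof (cases "a \<in> Domain p")
  case True
  then obtain b where "(a, b) \<in> p" by blast
  then have "insert (a, b) p = p" by blast
  then show ?thesis using p by (metis)
next
  case False
  \<comment> \<open>The image of \<open>a\<close> has to lie above \<open>L\<close> and below \<open>H\<close>, within the coset of \<open>a\<close>.\<close>
  define L where "L = snd ` {q \<in> p. fst q < a}"
  define H where "H = insert \<alpha> (snd ` {q \<in> p. a < fst q})"
  have fin: "finite L" "finite H" using p by (auto simp: L_def H_def partial_iso_def)
  have "(0, 0) \<in> p" using p by (simp add: partial_iso_def)
  then have "a \<noteq> 0" using False by blast
  then have "0 < a" using a sub by force
  then have "0 \<in> L" using \<open>(0, 0) \<in> p\<close> by (force simp: L_def)
  have lt: "l < h" if "l \<in> L" "h \<in> H" for l h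
  proof -
    obtain c where c: "(c, l) \<in> p" "c < a" using \<open>l \<in> L\<close> by (auto simp: L_def)
    then have "l < \<alpha>" using p sub by (force simp: partial_iso_def)
    moreover have "l < d" if "(c', d) \<in> p" "a < c'" for c' d
      using p c that by (force simp: partial_iso_def)
    ultimately show ?thesis using \<open>h \<in> H\<close> by (auto simp: H_def)
  qed
  have "Max L < Min H" using lt Max_in[OF fin(1)] Min_in[OF fin(2)] \<open>0 \<in> L\<close> by (auto simp: H_def)
  then have "Max L - a < Min H - a" by simp
  then obtain h where h: "h \<in> \<rat>" "Max L - a < h" "h < Min H - a" using Rats_dense_in_real by blast
  define b where "b = a + h"
  have Lb: "l < b" if "l \<in> L" for l using Max_ge[OF fin(1) that] h by (simp add: b_def)
  have bH: "b < u" if "u \<in> H" for u using Min_le[OF fin(2) that] h by (simp add: b_def)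
  have "b \<in> {0..<\<alpha>}" using Lb[OF \<open>0 \<in> L\<close>] bH[of \<alpha>] by (auto simp: H_def)
  then have "b \<in> D" using closed[OF a h(1)] by (simp add: b_def)
  have ord: "(a < c \<longleftrightarrow> b < d) \<and> (c < a \<longleftrightarrow> d < b)" if cd: "(c, d) \<in> p" for c d
  proof -
    have "c \<noteq> a" using cd False by blast
    then consider "c < a" "d \<in> L" | "a < c" "d \<in> H"
      using cd unfolding L_def H_def by (cases "c < a") force+
    then show ?thesis using Lb[of d] bH[of d] by cases auto
  qed
  then have "partial_iso (insert (a, b) p)"
    using p a h(1) \<open>b \<in> D\<close> unfolding partial_iso_def by (auto simp: b_def)
  then show ?thesis by blast
qed

lemma ex_order_automorphism:
  assumes p: "partial_iso p"
  obtains f where "bij_betw f D D" "\<And>s t. s \<in> D \<Longrightarrow> t \<in> D \<Longrightarrow> s < t \<Longrightarrow> f s < f t"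
    "\<And>t. t \<in> D \<Longrightarrow> f t - t \<in> \<rat>" "\<And>s t. (s, t) \<in> p \<Longrightarrow> f s = t"
proof -
  have ran: "\<exists>a. partial_iso (insert (a, b) q)" if q: "partial_iso q" and b: "b \<in> D" for q b
  proof -
    obtain a where "partial_iso (insert (b, a) (q\<inverse>))"
      using partial_iso_forth[OF partial_iso_converse[OF q] b] by blast
    then have "partial_iso ((insert (b, a) (q\<inverse>))\<inverse>)" by (rule partial_iso_converse)
    moreover have "(insert (b, a) (q\<inverse>))\<inverse> = insert (a, b) q" by auto
    ultimately show ?thesis by auto
  qed
  have "\<exists>R. p \<subseteq> R \<and> D \<subseteq> Domain R \<and> D \<subseteq> Range R \<and>
      (\<forall>u\<in>R. \<forall>v\<in>R. \<exists>q. partial_iso q \<and> u \<in> q \<and> v \<in> q)"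
    by (rule back_and_forth[of D partial_iso p, OF count p]) (fact partial_iso_forth ran)+
  then obtain R where R: "p \<subseteq> R" "D \<subseteq> Domain R" "D \<subseteq> Range R"
    and pair: "\<forall>u\<in>R. \<forall>v\<in>R. \<exists>q. partial_iso q \<and> u \<in> q \<and> v \<in> q"
    by (elim exE conjE)
  have ord: "a < c \<longleftrightarrow> b < d" if ab: "(a, b) \<in> R" and cd: "(c, d) \<in> R" for a b c d
  proof -
    obtain q where "partial_iso q" "(a, b) \<in> q" "(c, d) \<in> q" using pair ab cd by blast
    then show ?thesis unfolding partial_iso_def by blast
  qed
  have R': "a \<in> D" "b \<in> D" "b - a \<in> \<rat>" if ab: "(a, b) \<in> R" for a b
  proof -
    obtain q where "partial_iso q" "(a, b) \<in> q" using pair ab by blast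
    then show "a \<in> D" "b \<in> D" "b - a \<in> \<rat>" unfolding partial_iso_def by blast+
  qed
  have "\<forall>t\<in>D. \<exists>s. (t, s) \<in> R" using R(2) by blast
  from bchoice[OF this] obtain f where "\<forall>t\<in>D. (t, f t) \<in> R" ..
  then have f: "(t, f t) \<in> R" if "t \<in> D" for t using that by blast
  have uniq: "f s = t" if "(s, t) \<in> R" for s t
  proof -
    have "(s, f s) \<in> R" using f R'(1)[OF that] by blast
    then show ?thesis using ord[OF that, of s "f s"] ord[of s "f s", OF _ that] by fastforce
  qed
  have mono: "f s < f t" if "s \<in> D" "t \<in> D" "s < t" for s t using ord f that by blast
  have "bij_betw f D D"
  proof (rule bij_betw_imageI)
    show "inj_on f D" using mono by (intro linorder_inj_onI') fastforce
    show "f ` D = D"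
    proof
      show "f ` D \<subseteq> D" using f R' by blast
      show "D \<subseteq> f ` D"
      proof
        fix d assume "d \<in> D"
        then obtain a where "(a, d) \<in> R" using R(3) by blast
        then show "d \<in> f ` D" using uniq R'(1) by blast
      qed
    qed
  qed
  then show ?thesis
  proof (rule that[OF _ mono])
    show "f t - t \<in> \<rat>" if "t \<in> D" for t by (rule R'(3)[OF f[OF that]])
    show "f s = t" if "(s, t) \<in> p" for s t using uniq R(1) that by blast
  qed
qed

end

section \<open>Automorphisms of the graph on the circle\<close>
definition third_turn :: real  (\<open>\<alpha>\<close>) where
  "\<alpha> = 2 * pi / 3"

lemma third_turn_gt_2: "\<alpha> > 2" and three_third_turns: "3 * \<alpha> = 2 * pi"
  using pi_gt3 by (simp_all add: third_turn_def)

lemma cis_eq_cis_iff: "cis x = cis y \<longleftrightarrow> (\<exists>m::int. x = y + 3 * \<alpha> * m)"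
  unfolding three_third_turns using sin_cos_eq_iff[of x y] by (auto simp: complex_eq_iff)

text \<open>
  The edge relation in terms of real angles; one angle is moved by full turns to the other one.
\<close>
definition lifted_edge :: "real \<Rightarrow> real \<Rightarrow> bool" where
  "lifted_edge x y \<longleftrightarrow> (\<exists>m::int. x < y + 3 * \<alpha> * m \<and> y + 3 * \<alpha> * m < x + \<alpha>)"

lemma lifted_edge_cong:
  assumes "cis x = cis x'" "cis y = cis y'" shows "lifted_edge x y \<longleftrightarrow> lifted_edge x' y'"
proof -
  have *: "lifted_edge x' y'" if lifted_edge: "lifted_edge x y" and eq: "cis x = cis x'" "cis y = cis y'" for x y x' y'
  proof -
    obtain m :: int where m: "x < y + 3 * \<alpha> * m" "y + 3 * \<alpha> * m < x + \<alpha>"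
      using lifted_edge unfolding lifted_edge_def by blast
    obtain i j :: int where "x = x' + 3 * \<alpha> * i" "y = y' + 3 * \<alpha> * j"
      using eq by (auto simp: cis_eq_cis_iff)
    then show ?thesis using m unfolding lifted_edge_def
      by (intro exI[of _ "m + j - i"]) (auto simp: algebra_simps)
  qed
  show ?thesis using *[of x y x' y'] *[of x' y' x y] assms by auto
qed

lemma S3_edge_iff:
  assumes "x \<in> \<rat>" "y \<in> \<rat>"
  shows "[cis x, cis y] \<in> rel S3 \<longleftrightarrow> lifted_edge x y"
proof -
  have lifted_edge: "lifted_edge (of_rat q1) (of_rat q2) \<longleftrightarrow>
      (\<exists>m::int. of_rat (q2 - q1) \<in> {2 * pi * m <..< 2 * pi * m + 2 * pi / 3})" (is "?L \<longleftrightarrow> ?R") for q1 q2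
  proof
    assume ?L
    then obtain m :: int where "of_rat q1 < of_rat q2 + 3 * \<alpha> * m" "of_rat q2 + 3 * \<alpha> * m < of_rat q1 + \<alpha>"
      by (auto simp: lifted_edge_def)
    then show ?R by (intro exI[of _ "- m"]) (auto simp: third_turn_def of_rat_diff algebra_simps)
  next
    assume ?R
    then obtain m :: int where "of_rat (q2 - q1) \<in> {2 * pi * m <..< 2 * pi * m + 2 * pi / 3}" by blast
    then show ?L unfolding lifted_edge_def by (intro exI[of _ "- m"]) (auto simp: third_turn_def of_rat_diff algebra_simps)
  qed
  have "[cis x, cis y] \<in> rel S3 \<longleftrightarrow>
    (\<exists>q1 q2 :: rat. cis x = cis (of_rat q1) \<and> cis y = cis (of_rat q2) \<and> lifted_edge (of_rat q1) (of_rat q2))"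
    unfolding lifted_edge by (auto simp: S3_def)
  also have "\<dots> \<longleftrightarrow> lifted_edge x y"
  proof
    obtain q1 where q1: "x = of_rat q1" using assms(1) by (rule Rats_cases)
    obtain q2 where q2: "y = of_rat q2" using assms(2) by (rule Rats_cases)
    then show "\<exists>q1 q2 :: rat. cis x = cis (of_rat q1) \<and> cis y = cis (of_rat q2) \<and> lifted_edge (of_rat q1) (of_rat q2)"
      if "lifted_edge x y" using that q1 q2 by blast
  qed (use lifted_edge_cong in blast)
  finally show ?thesis .
qed

lemma S3_universe: "universe S3 = cis ` \<rat>"
  by (auto simp: S3_def Rats_def)

lemma S3_rel_length: "xs \<in> rel S3 \<Longrightarrow> length xs = 2"
  by (auto simp: S3_def)

text \<open>
  The rational angles together with their translates by multiples of a third of a turn: the ends of the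
  arcs of length \<open>\<alpha>\<close> that begin at vertices lie here, and so do all lifts of vertices.
\<close>
definition rational_translates :: "real set" where
  "rational_translates = {x. \<exists>k::int. x - \<alpha> * k \<in> \<rat>}"

lemma Rats_rational_translates: "x \<in> \<rat> \<Longrightarrow> x \<in> rational_translates"
  unfolding rational_translates_def by (auto intro!: exI[of _ 0])

lemma rational_translates_shift: "x \<in> rational_translates \<Longrightarrow> x + \<alpha> * of_int k \<in> rational_translates"
proof -
  assume "x \<in> rational_translates"
  then obtain l :: int where "x - \<alpha> * l \<in> \<rat>" by (auto simp: rational_translates_def)
  then show ?thesis unfolding rational_translates_def by (intro CollectI exI[of _ "l + k"]) (simp add: algebra_simps)
qed

text \<open>
  An edge from \<open>x\<close> to \<open>y\<close> means \<open>x < y < x + \<alpha>\<close> up to full turns. A monotone map \<open>F\<close> that commutes with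
  the translation by \<open>\<alpha>\<close> preserves these inequalities, and it descends to the circle as it commutes
  with full turns.
\<close>
lemma S3_automorphism_of_lift:
  assumes shift: "\<And>x (k::int). F (x + \<alpha> * k) = F x + \<alpha> * k"
    and rat: "\<And>x. x \<in> \<rat> \<Longrightarrow> F x \<in> \<rat>" and surj: "\<And>y. y \<in> \<rat> \<Longrightarrow> \<exists>x\<in>\<rat>. F x = y"
    and mono: "\<And>x y. x \<in> rational_translates \<Longrightarrow> y \<in> rational_translates \<Longrightarrow> x < y \<Longrightarrow> F x < F y"
  obtains g where "g \<in> carrier (Aut S3)" "\<And>x. x \<in> \<rat> \<Longrightarrow> g (cis x) = cis (F x)"
proof -
  have less_iff: "x < y \<longleftrightarrow> F x < F y" and eq_iff: "x = y \<longleftrightarrow> F x = F y"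
    if "x \<in> rational_translates" "y \<in> rational_translates" for x y
    using mono[OF that] mono[OF that(2,1)] by (cases x y rule: linorder_cases; force)+
  have shift3: "F (x + 3 * \<alpha> * m) = F x + 3 * \<alpha> * m" for x and m :: int
    using shift[of x "3 * m"] by (simp add: algebra_simps)
  have shift1: "F (x + \<alpha>) = F x + \<alpha>" for x using shift[of x 1] by simp
  have translates3: "x + 3 * \<alpha> * m \<in> rational_translates" "x + \<alpha> \<in> rational_translates" if "x \<in> \<rat>" for x and m :: int
    using rational_translates_shift[OF Rats_rational_translates[OF that], of "3 * m"] rational_translates_shift[OF Rats_rational_translates[OF that], of 1]
    by (simp_all add: algebra_simps)
  have cis_iff: "cis x = cis y \<longleftrightarrow> cis (F x) = cis (F y)" if "x \<in> \<rat>" "y \<in> \<rat>" for x y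
    unfolding cis_eq_cis_iff shift3[symmetric]
    using eq_iff[OF Rats_rational_translates[OF that(1)] translates3(1)[OF that(2)]] by simp
  have lifted_edge_iff: "lifted_edge x y \<longleftrightarrow> lifted_edge (F x) (F y)" if "x \<in> \<rat>" "y \<in> \<rat>" for x y
    unfolding lifted_edge_def shift3[symmetric] shift1[symmetric]
    using less_iff[OF Rats_rational_translates[OF that(1)] translates3(1)[OF that(2)]]
      less_iff[OF translates3(1)[OF that(2)] translates3(2)[OF that(1)]] by simp
  define g where "g = (\<lambda>z\<in>universe S3. cis (F (SOME x. x \<in> \<rat> \<and> z = cis x)))"
  have g: "g (cis x) = cis (F x)" if x: "x \<in> \<rat>" for x
  proof -
    define x' where "x' = (SOME x'. x' \<in> \<rat> \<and> cis x = cis x')"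
    have "x' \<in> \<rat> \<and> cis x = cis x'" unfolding x'_def by (rule someI[of _ x]) (use x in simp)
    then have "cis (F x') = cis (F x)" using cis_iff[of x x'] x by simp
    moreover have "g (cis x) = cis (F x')" using x by (simp add: g_def x'_def S3_universe)
    ultimately show ?thesis by simp
  qed
  have "inj_on g (cis ` \<rat>)"
    using cis_iff g by (auto simp: inj_on_def)
  moreover have "g ` cis ` \<rat> = cis ` \<rat>"
  proof
    show "g ` cis ` \<rat> \<subseteq> cis ` \<rat>" using g rat by auto
    show "cis ` \<rat> \<subseteq> g ` cis ` \<rat>"
    proof
      fix z assume "z \<in> cis ` (\<rat> :: real set)"
      then obtain y where y: "y \<in> \<rat>" "z = cis y" by blast
      obtain x where "x \<in> \<rat>" "F x = y" using surj[OF y(1)] by blast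
      then show "z \<in> g ` cis ` \<rat>" using g y by (intro image_eqI[of _ _ "cis x"]) auto
    qed
  qed
  ultimately have bij: "bij_betw g (universe S3) (universe S3)"
    by (simp add: bij_betw_def S3_universe)
  have "xs \<in> rel S3 \<longleftrightarrow> map g xs \<in> rel S3" if xs: "xs \<in> lists (universe S3)" for xs
  proof (cases "length xs = 2")
    case True
    then obtain z w where zw: "xs = [z, w]" by (auto simp: numeral_eq_Suc length_Suc_conv)
    then obtain x y where xy: "x \<in> \<rat>" "z = cis x" "y \<in> \<rat>" "w = cis y"
      using xs by (auto simp: S3_universe)
    then show ?thesis
      using S3_edge_iff[of x y] S3_edge_iff[of "F x" "F y"] lifted_edge_iff[of x y] rat g by (simp add: zw)
  next
    case False
    then show ?thesis using S3_rel_length[of xs] S3_rel_length[of "map g xs"] by auto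
  qed
  then have "g \<in> carrier (Aut S3)"
    using bij by (auto simp: carrier_Aut Bij_def is_isomorphism_def g_def)
  then show ?thesis using g that by blast
qed

lemma S3_rotation:
  assumes "q \<in> \<rat>"
  obtains g where "g \<in> carrier (Aut S3)" "\<And>x. x \<in> \<rat> \<Longrightarrow> g (cis x) = cis (x + q)"
proof -
  have "\<exists>x\<in>\<rat>. x + q = y" if "y \<in> \<rat>" for y
    using assms that by (intro bexI[of _ "y - q"]) auto
  then show ?thesis
    using S3_automorphism_of_lift[of "\<lambda>x. x + q"] assms that by auto
qed

text \<open>
  A strictly increasing bijection \<open>f\<close> of the angles in \<open>[0, \<alpha>)\<close> that moves every angle within its coset of
  the rationals extends, by commuting with the translation by \<open>\<alpha>\<close>, to a lift \<open>F\<close> of an automorphism;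
  since \<open>F x - x\<close> is always rational, \<open>F\<close> preserves the rational angles. Back and forth provides such an
  \<open>f\<close> with \<open>f 0 = 0\<close> and \<open>f 1 = 2\<close>, where \<open>2 < \<alpha>\<close>.
\<close>
lemma S3_stretch:
  obtains g where "g \<in> carrier (Aut S3)" "g (cis 0) = cis 0" "g (cis 1) = cis 2"
proof -
  define D where "D = rational_translates \<inter> {0..<\<alpha>}"
  have \<alpha>: "\<alpha> > 0" using third_turn_gt_2 by simp
  have "rational_translates \<subseteq> (\<Union>k::int. (\<lambda>q. q + \<alpha> * k) ` \<rat>)"
  proof
    fix x assume "x \<in> rational_translates"
    then obtain k :: int where "x - \<alpha> * k \<in> \<rat>" unfolding rational_translates_def by blast
    then show "x \<in> (\<Union>k::int. (\<lambda>q. q + \<alpha> * k) ` \<rat>)"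
      by (intro UN_I[of k] image_eqI[of _ _ "x - \<alpha> * k"]) auto
  qed
  then have "countable rational_translates"
    by (rule countable_subset) (intro countable_UN countable_image countable_rat; simp)
  then have "countable D" by (simp add: D_def)
  interpret coset_interval D \<alpha>
  proof
    fix t h assume "t \<in> D" "h \<in> \<rat>" "t + h \<in> {0..<\<alpha>}"
    moreover from this obtain k :: int where "t - \<alpha> * k \<in> \<rat>" by (auto simp: D_def rational_translates_def)
    then have "(t - \<alpha> * k) + h \<in> \<rat>" using \<open>h \<in> \<rat>\<close> by (rule Rats_add)
    then have "t + h \<in> rational_translates" unfolding rational_translates_def by (auto intro!: exI[of _ k] simp: algebra_simps)
    ultimately show "t + h \<in> D" by (simp add: D_def)
  qed (use \<open>countable D\<close> in \<open>auto simp: D_def\<close>)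
  have "{0, 1, 2} \<subseteq> D" using third_turn_gt_2 Rats_rational_translates by (auto simp: D_def)
  then have "partial_iso {(0, 0), (1, 2)}" by (auto simp: partial_iso_def)
  then obtain f where f: "bij_betw f D D" "\<And>s t. s \<in> D \<Longrightarrow> t \<in> D \<Longrightarrow> s < t \<Longrightarrow> f s < f t"
    "\<And>t. t \<in> D \<Longrightarrow> f t - t \<in> \<rat>" "\<And>s t. (s, t) \<in> {(0, 0), (1, 2)} \<Longrightarrow> f s = t"
    by (rule ex_order_automorphism) blast
  have fD: "f t \<in> D" if "t \<in> D" for t using f(1) that by (auto simp: bij_betw_def)
  define K where "K x = \<lfloor>x / \<alpha>\<rfloor>" for x
  define F where "F x = f (x - \<alpha> * K x) + \<alpha> * K x" for x
  have K: "K (t + \<alpha> * k) = k" if "t \<in> {0..<\<alpha>}" for t and k :: int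
  proof -
    have "(t + \<alpha> * k) / \<alpha> = t / \<alpha> + k" using \<alpha> by (simp add: field_simps)
    moreover have "\<lfloor>t / \<alpha>\<rfloor> = 0" using that \<alpha> by (simp add: floor_eq_iff)
    ultimately show ?thesis by (simp add: K_def)
  qed
  have F: "F (t + \<alpha> * k) = f t + \<alpha> * k" if "t \<in> {0..<\<alpha>}" for t and k :: int
    using K[OF that] by (simp add: F_def)
  have decomp: "\<exists>t (k::int). t \<in> {0..<\<alpha>} \<and> x = t + \<alpha> * k" for x
  proof (rule exI[of _ "x - \<alpha> * K x"], rule exI[of _ "K x"], rule conjI)
    have "K x \<le> x / \<alpha>" "x / \<alpha> < K x + 1" unfolding K_def by linarith+
    then show "x - \<alpha> * K x \<in> {0..<\<alpha>}" using \<alpha> by (auto simp: field_simps)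
  qed simp
  have decompD: "\<exists>t (k::int). t \<in> D \<and> x = t + \<alpha> * k" if "x \<in> rational_translates" for x
  proof -
    obtain t k where t: "t \<in> {0..<\<alpha>}" "x = t + \<alpha> * of_int k" using decomp by blast
    then have "t \<in> rational_translates" using rational_translates_shift[OF that, of "- k"] by simp
    then show ?thesis using t by (auto simp: D_def)
  qed
  have D: "t \<in> {0..<\<alpha>}" "t \<in> rational_translates" if "t \<in> D" for t using that by (auto simp: D_def)
  have shift: "F (x + \<alpha> * k) = F x + \<alpha> * k" for x and k :: int
  proof -
    obtain t l where t: "t \<in> {0..<\<alpha>}" "x = t + \<alpha> * of_int l" using decomp by blast
    then have "x + \<alpha> * k = t + \<alpha> * of_int (l + k)" by (simp add: algebra_simps)
    then show ?thesis using F[OF t(1), of l] F[OF t(1), of "l + k"] t(2) by (simp add: algebra_simps)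
  qed
  have moves: "F x - x \<in> \<rat>" if x: "x \<in> rational_translates" for x
  proof -
    obtain t k where t: "t \<in> D" "x = t + \<alpha> * of_int k" using decompD[OF x] by blast
    then show ?thesis using F[OF D(1)[OF t(1)], of k] f(3)[OF t(1)] by simp
  qed
  have rat: "F x \<in> \<rat>" if "x \<in> \<rat>" for x
    using Rats_add[OF moves[OF Rats_rational_translates[OF that]] that] by simp
  have surj: "\<exists>x\<in>\<rat>. F x = y" if y: "y \<in> \<rat>" for y
  proof -
    obtain t k where t: "t \<in> D" "y = t + \<alpha> * of_int k" using decompD[OF Rats_rational_translates[OF y]] by blast
    have "t \<in> f ` D" using f(1) t(1) by (simp add: bij_betw_def)
    then obtain s where s: "s \<in> D" "f s = t" by blast
    have eq: "F (s + \<alpha> * k) = y" using F[OF D(1)[OF s(1)], of k] s t by simp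
    have "y - (s + \<alpha> * k) \<in> \<rat>" using moves[OF rational_translates_shift[OF D(2)[OF s(1)]], of k] eq by simp
    then have "y - (y - (s + \<alpha> * k)) \<in> \<rat>" using y Rats_diff by blast
    then show ?thesis using eq by (intro bexI[of _ "s + \<alpha> * k"]) auto
  qed
  have mono: "F x < F y" if x: "x \<in> rational_translates" and y: "y \<in> rational_translates" and "x < y" for x y
  proof -
    obtain s k where s: "s \<in> D" "x = s + \<alpha> * of_int k" using decompD[OF x] by blast
    obtain t l where t: "t \<in> D" "y = t + \<alpha> * of_int l" using decompD[OF y] by blast
    have Fx: "F x = f s + \<alpha> * k" and Fy: "F y = f t + \<alpha> * l" using F D(1) s t by auto
    have b: "0 \<le> s" "s < \<alpha>" "0 \<le> t" "t < \<alpha>" "0 \<le> f s" "f s < \<alpha>" "0 \<le> f t" "f t < \<alpha>"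
      using D(1)[OF s(1)] D(1)[OF t(1)] D(1)[OF fD[OF s(1)]] D(1)[OF fD[OF t(1)]] by auto
    have "k \<le> l"
    proof (rule ccontr)
      assume "\<not> k \<le> l"
      then have "real_of_int (l + 1) \<le> real_of_int k" by linarith
      then have "\<alpha> * (l + 1) \<le> \<alpha> * k" using \<alpha> by (intro mult_left_mono) auto
      then show False using \<open>x < y\<close> s t b by (simp add: algebra_simps)
    qed
    then consider "k = l" | "k + 1 \<le> l" by linarith
    then show ?thesis
    proof cases
      case 1
      then show ?thesis using f(2)[OF s(1) t(1)] \<open>x < y\<close> s t Fx Fy by simp
    next
      case 2
      then have "real_of_int (k + 1) \<le> real_of_int l" by linarith
      then have "\<alpha> * (k + 1) \<le> \<alpha> * l" using \<alpha> by (intro mult_left_mono) auto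
      then show ?thesis using b Fx Fy by (simp add: algebra_simps)
    qed
  qed
  obtain g where g: "g \<in> carrier (Aut S3)" "\<And>x. x \<in> \<rat> \<Longrightarrow> g (cis x) = cis (F x)"
    using S3_automorphism_of_lift[OF shift rat surj mono] by blast
  have "F 0 = 0" "F 1 = 2" using F[of 0 0] F[of 1 0] f(4) third_turn_gt_2 by auto
  then show ?thesis using that[OF g(1)] g(2)[of 0] g(2)[of 1] by simp
qed

section \<open>Arcs of a third of a turn\<close>
definition base_arc :: "complex list set" where
  "base_arc = {[cis x] | x. 0 \<le> x \<and> x < \<alpha>}"

lemma base_arc_iff: "[cis x] \<in> base_arc \<longleftrightarrow> (\<exists>m::int. 3 * \<alpha> * m \<le> x \<and> x < 3 * \<alpha> * m + \<alpha>)"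
proof
  assume "[cis x] \<in> base_arc"
  then obtain y where y: "cis x = cis y" "0 \<le> y" "y < \<alpha>" by (auto simp: base_arc_def)
  then obtain m :: int where "x = y + 3 * \<alpha> * m" by (auto simp: cis_eq_cis_iff)
  then show "\<exists>m::int. 3 * \<alpha> * m \<le> x \<and> x < 3 * \<alpha> * m + \<alpha>" using y by (intro exI[of _ m]) auto
next
  assume "\<exists>m::int. 3 * \<alpha> * m \<le> x \<and> x < 3 * \<alpha> * m + \<alpha>"
  then obtain m :: int where m: "3 * \<alpha> * m \<le> x" "x < 3 * \<alpha> * m + \<alpha>" by blast
  have "cis x = cis (x - 3 * \<alpha> * m)" unfolding cis_eq_cis_iff by (intro exI[of _ m]) auto
  then show "[cis x] \<in> base_arc" using m unfolding base_arc_def by auto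
qed

lemma S3_edge_lift:
  assumes "[cis x, w] \<in> rel S3"
  obtains y where "w = cis y" "x < y" "y < x + \<alpha>"
proof -
  obtain q1 q2 :: rat where q: "cis x = cis (of_rat q1)" "w = cis (of_rat q2)"
    using assms by (auto simp: S3_def)
  have "[cis (of_rat q1), cis (of_rat q2)] \<in> rel S3" using assms q by simp
  then have "lifted_edge (of_rat q1) (of_rat q2)" by (subst (asm) S3_edge_iff) auto
  then have "lifted_edge x (of_rat q2)" using lifted_edge_cong q(1) by blast
  then obtain m :: int where "x < of_rat q2 + 3 * \<alpha> * m" "of_rat q2 + 3 * \<alpha> * m < x + \<alpha>"
    by (auto simp: lifted_edge_def)
  moreover have "w = cis (of_rat q2 + 3 * \<alpha> * m)" unfolding q(2) cis_eq_cis_iff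
    by (intro exI[of _ "- m"]) auto
  ultimately show ?thesis using that by blast
qed

text \<open>
  The three vertices lie in this order on an arc shorter than \<open>\<alpha>\<close>. An arc of length \<open>\<alpha>\<close> is too long to
  contain only the middle one, and the rest of the circle, of length \<open>2 \<alpha>\<close>, is too long for the middle
  one to be the only one outside.
\<close>
lemma base_arc_convex:
  assumes xy: "[u, v] \<in> rel S3" and yz: "[v, w] \<in> rel S3" and xz: "[u, w] \<in> rel S3"
  shows "([u] \<in> base_arc \<longleftrightarrow> [v] \<in> base_arc) \<or> ([v] \<in> base_arc \<longleftrightarrow> [w] \<in> base_arc)"
proof -
  obtain x where x: "u = cis x" using xy by (auto simp: S3_def)
  obtain y where y: "v = cis y" "x < y" "y < x + \<alpha>" using S3_edge_lift xy x by blast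
  obtain z where z: "w = cis z" "y < z" "z < y + \<alpha>" using S3_edge_lift yz y(1) by blast
  obtain z' where z': "w = cis z'" "x < z'" "z' < x + \<alpha>" using S3_edge_lift xz x by blast
  have \<alpha>: "\<alpha> > 0" using third_turn_gt_2 by simp
  have zero: "m = 0" if "3 * \<alpha> * of_int m < 3 * \<alpha>" "- (3 * \<alpha>) < 3 * \<alpha> * of_int m" for m :: int
  proof -
    have "\<alpha> * of_int m < \<alpha> * of_int 1" "\<alpha> * of_int (- 1) < \<alpha> * of_int m" using that by simp_all
    then have "m < 1" "- 1 < m" using \<alpha> by (simp_all only: mult_less_cancel_left_pos of_int_less_iff)
    then show ?thesis by linarith
  qed
  \<comment> \<open>The lift of \<open>w\<close> reached through \<open>v\<close> agrees with the one reached directly from \<open>u\<close>.\<close>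
  obtain m :: int where m: "z = z' + 3 * \<alpha> * m" using z(1) z'(1) cis_eq_cis_iff by metis
  have "m = 0"
  proof (rule zero)
    show "3 * \<alpha> * m < 3 * \<alpha>" "- (3 * \<alpha>) < 3 * \<alpha> * m" using m \<alpha> y(2,3) z(2,3) z'(2,3) by linarith+
  qed
  then have zx: "z < x + \<alpha>" using m z' by simp
  show ?thesis
  proof (rule ccontr)
    assume neg: "\<not> ?thesis"
    show False
    proof (cases "[v] \<in> base_arc")
      case True
      then obtain m :: int where m: "3 * \<alpha> * m \<le> y" "y < 3 * \<alpha> * m + \<alpha>" by (auto simp: y base_arc_iff)
      have "[u] \<notin> base_arc" "[w] \<notin> base_arc" using neg True by auto
      then have "\<not> 3 * \<alpha> * m \<le> x" "\<not> z < 3 * \<alpha> * m + \<alpha>"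
        using m y(2) z(2) unfolding x z(1) base_arc_iff by (meson less_trans le_less_trans less_imp_le order_trans)+
      then show False using zx by linarith
    next
      case False
      then obtain m n :: int where mn: "3 * \<alpha> * m \<le> x" "x < 3 * \<alpha> * m + \<alpha>" "3 * \<alpha> * n \<le> z" "z < 3 * \<alpha> * n + \<alpha>"
        using neg unfolding x z(1) base_arc_iff by blast
      have "m - n = 0"
      proof (rule zero)
        have "3 * \<alpha> * of_int (m - n) = 3 * \<alpha> * m - 3 * \<alpha> * n" by (simp add: algebra_simps)
        then show "3 * \<alpha> * of_int (m - n) < 3 * \<alpha>" "- (3 * \<alpha>) < 3 * \<alpha> * of_int (m - n)"
          using mn y(2) z(2) zx \<alpha> by linarith+
      qed
      then have "m = n" by simp
      then have "[v] \<in> base_arc" using mn y z unfolding y(1) base_arc_iff by (intro exI[of _ m]) auto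
      then show False using False by simp
    qed
  qed
qed

text \<open>
  The first point of the sequence beyond \<open>t\<close> is still close to \<open>t\<close>.
\<close>
lemma steps_enter_interval:
  fixes x :: "nat \<Rightarrow> real"
  assumes step: "\<And>i. i < n \<Longrightarrow> x (Suc i) < x i + \<alpha>" and "x 0 \<le> t" "t \<le> x n" "\<alpha> > 0"
  obtains i where "i \<le> n" "t \<le> x i" "x i < t + \<alpha>"
proof -
  define i where "i = (LEAST i. t \<le> x i)"
  have i: "t \<le> x i" unfolding i_def by (rule LeastI) fact
  have "i \<le> n" unfolding i_def by (rule Least_le) fact
  moreover have "x i < t + \<alpha>"
  proof (cases i)
    case 0
    then show ?thesis using assms by simp
  next
    case (Suc j)
    then have "\<not> t \<le> x j" unfolding i_def by (metis lessI not_less_Least)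
    then show ?thesis using step[of j] Suc \<open>i \<le> n\<close> by simp
  qed
  ultimately show ?thesis using that i by blast
qed

text \<open>
  Lifted to the reals, a closed walk makes steps shorter than \<open>\<alpha>\<close> and ends at least a full turn after its
  start, so it enters every half-open arc of length \<open>\<alpha>\<close>. This applies to the given arc and to the one
  that follows it.
\<close>
lemma closed_walk_meets_base_arc:
  assumes walk: "\<And>i. i < n \<Longrightarrow> [u i, u (Suc i)] \<in> rel S3" and closed: "u n = u 0" and "n > 0"
  shows "\<exists>i\<le>n. [u i] \<in> base_arc" "\<exists>i\<le>n. [u i] \<notin> base_arc"
proof -
  have \<alpha>: "\<alpha> > 0" using third_turn_gt_2 by simp
  obtain x\<^sub>0 where x\<^sub>0: "u 0 = cis x\<^sub>0" using walk[OF \<open>n > 0\<close>] by (auto simp: S3_def)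
  have "\<exists>x. \<forall>i. ((i \<le> n \<longrightarrow> u i = cis (x i)) \<and> (i = 0 \<longrightarrow> x i = x\<^sub>0)) \<and>
     (i < n \<longrightarrow> x i < x (Suc i) \<and> x (Suc i) < x i + \<alpha>)"
  proof (rule dependent_nat_choice)
    fix y i assume y: "(i \<le> n \<longrightarrow> u i = cis y) \<and> (i = 0 \<longrightarrow> y = x\<^sub>0)"
    show "\<exists>z. ((Suc i \<le> n \<longrightarrow> u (Suc i) = cis z) \<and> (Suc i = 0 \<longrightarrow> z = x\<^sub>0)) \<and>
        (i < n \<longrightarrow> y < z \<and> z < y + \<alpha>)"
    proof (cases "i < n")
      case True
      then have "[cis y, u (Suc i)] \<in> rel S3" using walk[of i] y by simp
      then show ?thesis by (rule S3_edge_lift) auto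
    qed auto
  qed (use x\<^sub>0 in auto)
  then obtain x where x: "\<And>i. i \<le> n \<Longrightarrow> u i = cis (x i)" "\<And>i. i < n \<Longrightarrow> x i < x (Suc i)"
    "\<And>i. i < n \<Longrightarrow> x (Suc i) < x i + \<alpha>" by blast
  have "x 0 < x n"
    by (rule lift_Suc_mono_less_ivl[of "{..<n}" x]) (use x(2) \<open>n > 0\<close> in auto)
  obtain m :: int where m: "x n = x 0 + 3 * \<alpha> * m"
    using closed x(1)[of n] x(1)[of 0] by (auto simp: cis_eq_cis_iff)
  have "0 < 3 * \<alpha> * m" using m \<open>x 0 < x n\<close> by simp
  then have "m \<ge> 1" using \<alpha> by (simp add: zero_less_mult_iff)
  then have "3 * \<alpha> * 1 \<le> 3 * \<alpha> * m" using \<alpha> by (intro mult_left_mono) auto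
  then have long: "x 0 + 3 * \<alpha> \<le> x n" using m by simp
  have hit: "\<exists>i\<le>n. \<exists>k::int. s + 3 * \<alpha> * k \<le> x i \<and> x i < s + 3 * \<alpha> * k + \<alpha>" for s
  proof -
    define k where "k = \<lceil>(x 0 - s) / (3 * \<alpha>)\<rceil>"
    have "(x 0 - s) / (3 * \<alpha>) \<le> k" "k < (x 0 - s) / (3 * \<alpha>) + 1" unfolding k_def by linarith+
    then have "x 0 \<le> s + 3 * \<alpha> * k" "s + 3 * \<alpha> * k \<le> x n"
      using \<alpha> long by (auto simp: field_simps)
    then obtain i where "i \<le> n" "s + 3 * \<alpha> * k \<le> x i" "x i < s + 3 * \<alpha> * k + \<alpha>"
      using steps_enter_interval[of n x _ , OF x(3)] \<alpha> by blast
    then show ?thesis by blast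
  qed
  show "\<exists>i\<le>n. [u i] \<in> base_arc"
    using hit[of 0] x(1) base_arc_iff by (metis add_0)
  obtain i and k :: int where i: "i \<le> n" "\<alpha> + 3 * \<alpha> * k \<le> x i" "x i < \<alpha> + 3 * \<alpha> * k + \<alpha>"
    using hit[of \<alpha>] by blast
  have "[u i] \<notin> base_arc"
  proof
    assume "[u i] \<in> base_arc"
    then obtain l :: int where l: "3 * \<alpha> * l \<le> x i" "x i < 3 * \<alpha> * l + \<alpha>"
      using x(1)[OF i(1)] base_arc_iff by auto
    have "3 * \<alpha> * k < 3 * \<alpha> * l" using i l by linarith
    then have "k < l" using \<alpha> by simp
    then have "real_of_int (k + 1) \<le> l" by linarith
    then have "3 * \<alpha> * (k + 1) \<le> 3 * \<alpha> * l" using \<alpha> by (intro mult_left_mono) auto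
    then show False using i l \<alpha> by (simp add: algebra_simps)
  qed
  then show "\<exists>i\<le>n. [u i] \<notin> base_arc" using i by blast
qed

text \<open>
  Let \<open>c\<close> be the probability of separating two vertices. As \<open>S\<close> is convex on the vertices at the angles
  \<open>0, 1, 2\<close>, one has \<open>c(0, 2) = c(0, 1) + c(1, 2)\<close>, while \<open>c(0, 2) = c(0, 1)\<close> by the automorphism that
  fixes \<open>0\<close> and moves \<open>1\<close> to \<open>2\<close>. So \<open>c(1, 2) = 0\<close>, and by rotation \<open>c(i, i + 1) = 0\<close> for all \<open>i\<close>. The
  vertices \<open>0, 1, \<dots>, 6\<close> form a closed walk since \<open>6 < 2 \<pi> < 6 + \<alpha>\<close>, and the sum over its steps
  contradicts the fact that \<open>S\<close> contains some but not all of them.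
\<close>
theorem Aut_S3_not_amenable: "\<not> amenable (Aut S3) (Aut_topology S3)"
proof
  assume amen: "amenable (Aut S3) (Aut_topology S3)"
  let ?U = "universe S3"
  obtain M :: "(complex list \<Rightarrow> bool) measure" where "prob_space M"
    and meas: "\<And>xs. xs \<in> lists ?U \<Longrightarrow> {S \<in> space M. S xs} \<in> sets M"
    and inv: "\<And>g A. g \<in> carrier (Aut S3) \<Longrightarrow> A \<in> sets M \<Longrightarrow>
       measure M {S \<in> space M. pull_back S3 g S \<in> A} = measure M A"
    and pull: "\<And>g S. g \<in> carrier (Aut S3) \<Longrightarrow> S \<in> space M \<Longrightarrow> pull_back S3 g S \<in> space M"
    and approx: "\<And>S F. S \<in> space M \<Longrightarrow> finite F \<Longrightarrow> F \<subseteq> lists ?U \<Longrightarrow>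
       \<exists>g\<in>carrier (Aut S3). \<forall>xs\<in>F. S xs \<longleftrightarrow> map g xs \<in> base_arc"
    using amenable_imp_invariant_random_relation[OF amen, of base_arc] by blast
  interpret M: prob_space M by fact
  have vertex: "cis x \<in> ?U" if "x \<in> \<rat>" for x using that by (simp add: S3_universe)
  have g_edge: "[g u, g v] \<in> rel S3" if "g \<in> carrier (Aut S3)" "[u, v] \<in> rel S3" "u \<in> ?U" "v \<in> ?U" for g u v
    using map_Aut_rel[of g S3 "[u, v]"] that by simp
  have edge: "[cis x, cis y] \<in> rel S3" if "x \<in> \<rat>" "y \<in> \<rat>" "x < y" "y < x + \<alpha>" for x y
    unfolding S3_edge_iff[OF that(1,2)] lifted_edge_def using that by (intro exI[of _ 0]) auto
  define cut where "cut u v = {S \<in> space M. S [u] \<noteq> S [v]}" for u v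
  have cut_sets: "cut u v \<in> sets M" if "u \<in> ?U" "v \<in> ?U" for u v
  proof -
    have "{S \<in> space M. S [u]} \<in> sets M" "{S \<in> space M. S [v]} \<in> sets M"
      using meas[of "[u]"] meas[of "[v]"] that by auto
    then have "({S \<in> space M. S [u]} - {S \<in> space M. S [v]}) \<union>
      ({S \<in> space M. S [v]} - {S \<in> space M. S [u]}) \<in> sets M" by auto
    also have "({S \<in> space M. S [u]} - {S \<in> space M. S [v]}) \<union>
      ({S \<in> space M. S [v]} - {S \<in> space M. S [u]}) = cut u v" by (auto simp: cut_def)
    finally show ?thesis .
  qed
  have cut_inv: "measure M (cut (g u) (g v)) = measure M (cut u v)"
    if g: "g \<in> carrier (Aut S3)" and uv: "u \<in> ?U" "v \<in> ?U" for g u v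
  proof -
    have "{S \<in> space M. pull_back S3 g S \<in> cut u v} = cut (g u) (g v)"
      using pull[OF g] uv by (auto simp: cut_def pull_back_def)
    then show ?thesis using inv[OF g cut_sets[OF uv]] by simp
  qed
  have convex: "(S [cis 0] \<longleftrightarrow> S [cis 1]) \<or> (S [cis 1] \<longleftrightarrow> S [cis 2])" if S: "S \<in> space M" for S
  proof -
    have "finite {[cis 0], [cis 1], [cis 2]}" "{[cis 0], [cis 1], [cis 2]} \<subseteq> lists ?U"
      using vertex by (auto simp del: cis_zero)
    from approx[OF S this] obtain g where g: "g \<in> carrier (Aut S3)"
      "\<forall>xs\<in>{[cis 0], [cis 1], [cis 2]}. S xs \<longleftrightarrow> map g xs \<in> base_arc" by (rule bexE)
    have "[cis 0, cis 1] \<in> rel S3" "[cis 1, cis 2] \<in> rel S3" "[cis 0, cis 2] \<in> rel S3"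
      using third_turn_gt_2 by (auto intro!: edge simp del: cis_zero)
    then have "[g (cis 0), g (cis 1)] \<in> rel S3" "[g (cis 1), g (cis 2)] \<in> rel S3"
      "[g (cis 0), g (cis 2)] \<in> rel S3"
      using g_edge[OF g(1)] vertex by (auto simp del: cis_zero)
    from base_arc_convex[OF this] show ?thesis using g(2) by (simp del: cis_zero)
  qed
  have "measure M (cut (cis 0) (cis 2)) = measure M (cut (cis 0) (cis 1) \<union> cut (cis 1) (cis 2))"
    using convex by (intro arg_cong[of _ _ "measure M"]) (auto simp: cut_def simp del: cis_zero)
  also have "\<dots> = measure M (cut (cis 0) (cis 1)) + measure M (cut (cis 1) (cis 2))"
    using convex vertex
    by (intro M.finite_measure_Union cut_sets) (auto simp: cut_def simp del: cis_zero)
  finally have sum: "measure M (cut (cis 0) (cis 2)) =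
    measure M (cut (cis 0) (cis 1)) + measure M (cut (cis 1) (cis 2))" .
  obtain g where g: "g \<in> carrier (Aut S3)" "g (cis 0) = cis 0" "g (cis 1) = cis 2" by (rule S3_stretch)
  have "measure M (cut (cis 0) (cis 2)) = measure M (cut (cis 0) (cis 1))"
    using cut_inv[OF g(1), of "cis 0" "cis 1"] g(2,3) vertex by (simp del: cis_zero)
  with sum have null12: "measure M (cut (cis 1) (cis 2)) = 0" by simp
  have null: "measure M (cut (cis x) (cis (x + 1))) = 0" if x: "x \<in> \<rat>" for x
  proof -
    have "x - 1 \<in> \<rat>" using x by simp
    then obtain h where h: "h \<in> carrier (Aut S3)" "\<And>y. y \<in> \<rat> \<Longrightarrow> h (cis y) = cis (y + (x - 1))"
      by (rule S3_rotation) blast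
    then have "h (cis 1) = cis x" "h (cis 2) = cis (x + 1)" using h(2)[of 1] h(2)[of 2] by (auto simp: add.commute)
    then show ?thesis using cut_inv[OF h(1), of "cis 1" "cis 2"] null12 vertex by simp
  qed
  \<comment> \<open>The closed walk through the angles \<open>0, \<dots>, 6\<close>; its last vertex repeats the first.\<close>
  define u where "u i = cis (if i < 7 then real i else 0)" for i
  have u_vertex: "u i \<in> ?U" for i using vertex by (auto simp: u_def simp del: cis_zero)
  have u_edge: "[u i, u (Suc i)] \<in> rel S3" if "i < 7" for i
  proof (cases "i = 6")
    case True
    have "lifted_edge 6 0"
      unfolding lifted_edge_def by (rule exI[of _ 1]) (use pi_gt3 pi_less_4 in \<open>simp add: third_turn_def\<close>)
    then have "[cis 6, cis 0] \<in> rel S3" by (subst S3_edge_iff) auto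
    then show ?thesis by (simp add: u_def True)
  next
    case False
    then have "u i = cis (real i)" "u (Suc i) = cis (real i + 1)" using that by (auto simp: u_def add.commute)
    then show ?thesis using edge[of "real i" "real i + 1"] third_turn_gt_2 by simp
  qed
  have "space M \<subseteq> (\<Union>i\<in>{..<6}. cut (u i) (u (Suc i)))"
  proof
    fix S assume S: "S \<in> space M"
    have "finite ((\<lambda>i. [u i]) ` {..7})" "(\<lambda>i. [u i]) ` {..7} \<subseteq> lists ?U" using u_vertex by auto
    from approx[OF S this] obtain g where g: "g \<in> carrier (Aut S3)"
      "\<forall>xs\<in>(\<lambda>i. [u i]) ` {..7}. S xs \<longleftrightarrow> map g xs \<in> base_arc" by (rule bexE)
    have gS: "S [u i] \<longleftrightarrow> [g (u i)] \<in> base_arc" if "i \<le> 7" for i using g(2) that by auto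
    have "[g (u i), g (u (Suc i))] \<in> rel S3" if "i < 7" for i
      using g_edge[OF g(1) u_edge[OF that]] u_vertex by blast
    moreover have "g (u 7) = g (u 0)" by (simp add: u_def)
    ultimately obtain i j where ij: "i \<le> 7" "[g (u i)] \<in> base_arc" "j \<le> 7" "[g (u j)] \<notin> base_arc"
      using closed_walk_meets_base_arc[of 7 "\<lambda>i. g (u i)"] by auto
    show "S \<in> (\<Union>i\<in>{..<6}. cut (u i) (u (Suc i)))"
    proof (rule ccontr)
      assume "\<not> ?thesis"
      then have step: "S [u i] = S [u (Suc i)]" if "i < 6" for i using that S by (auto simp: cut_def)
      have const: "S [u i] = S [u 0]" if "i \<le> 6" for i
        using that by (induction i) (use step in auto)
      have "u 7 = u 0" by (simp add: u_def)
      then have "S [u i] = S [u 0]" if "i \<le> 7" for i using const[of i] that by (cases "i = 7") auto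
      then show False using ij gS by blast
    qed
  qed
  then have "measure M (space M) \<le> measure M (\<Union>i\<in>{..<6}. cut (u i) (u (Suc i)))"
    using cut_sets u_vertex by (intro M.finite_measure_mono) auto
  also have "\<dots> \<le> (\<Sum>i\<in>{..<6}. measure M (cut (u i) (u (Suc i))))"
    using cut_sets u_vertex by (intro measure_UNION_le) auto
  also have "\<dots> = (\<Sum>i\<in>{..<6::nat}. 0)"
  proof (rule sum.cong)
    fix i :: nat assume "i \<in> {..<6}"
    then show "measure M (cut (u i) (u (Suc i))) = 0"
      using null[of "real i"] by (simp add: u_def add.commute)
  qed simp
  finally show False by (simp add: M.prob_space)
qed

theorem theorem1p1:
  shows "\<not> amenable (Aut S3) (Aut_topology S3) \<and>
    (\<forall>T :: 'a rel_structure. is_Fraisse_limit T boron_class \<longrightarrow>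
       \<not> amenable (Aut T) (Aut_topology T))"
  using Aut_S3_not_amenable Aut_boron_Fraisse_limit_not_amenable by blast

end
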